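(* For all integers $r,s$ with $s\ge 2r\ge 4$ there exists $a_0=a_0(r,s)$ such that for all integers $a\ge a_0$, $$\mathrm{ex}_{\Pi}\left(s,\Sigma_{r,1}(a,s)\right)=(a+1)^{\frac{r-2+x_{\star}(r,1)}{r-1}}\,a^{\frac{1-x_{\star}(r,1)}{r-1}},$$ where $$x_{\star}(r,1):=\frac{\log\left(\frac{a+1}{a}\right)}{\log\left(\frac{(a+1)^r}{(a-1)^{r-1}a}\right)}.$$
   Context: A multigraph is a pair $G=(V,w)$ with $V$ a finite set and $w:V^{(2)}\to\mathbb{Z}_{\ge 0}$, where $V^{(2)}$ is the set of 2-element subsets of $V$. For integers $s\ge 2$, $q\ge 0$, $G$ is an $(s,q)$-graph if $\sum_{xy\in X^{(2)}}w(xy)\le q$ for every $s$-element subset $X\subseteq V$. $\mathcal{F}(n,s,q)$ is the set of all $(s,q)$-graphs on vertex set $[n]=\{1,\dots,n\}$. $P(G):=\prod_{uv\in V^{(2)}}w(uv)$ and $e(G):=\sum_{uv\in V^{(2)}}w(uv)$. Set $\mathrm{ex}_{\Pi}(n,s,q):=\max\{P(G):G\in\mathcal{F}(n,s,q)\}$ and $\mathrm{ex}_{\Pi}(s,q):=\lim_{n\to\infty}\left(\mathrm{ex}_{\Pi}(n,s,q)\right)^{1/\binom n2}$. For $a\geq 2$, $r\ge 1$, $\mathcal{T}_{r,1}(a,n)$ is the collection of multigraphs $G$ on $[n]$ whose vertex set can be partitioned into $r$ (possibly empty) parts $V_0,\dots,V_{r-1}$ such that all edges inside $V_0$ have multiplicity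 $a-1$, all edges inside $V_i$ have multiplicity $a$ for each $1\le i\le r-1$, and all other edges have multiplicity $a+1$. $\Sigma_{r,1}(a,n):=\max\{e(G):G\in\mathcal{T}_{r,1}(a,n)\}$. *)

theory Defs
  imports Complex_Main "HOL-Library.Ramsey" "HOL-Library.FuncSet" "HOL-Library.Disjoint_Sets"
begin

text \<open>A multigraph \<open>(V, w)\<close>. The set of two-element subsets of \<open>V\<close> is \<open>nsets V 2\<close>; the weight
  function is extensional, so that it carries no information outside this set.\<close>

type_synonym 'a multigraph = "'a set \<times> ('a set \<Rightarrow> nat)"

abbreviation verts :: "'a multigraph \<Rightarrow> 'a set" where
  "verts G \<equiv> fst G"

abbreviation mult :: "'a multigraph \<Rightarrow> 'a set \<Rightarrow> nat" where
  "mult G \<equiv> snd G"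

definition multigraph :: "'a multigraph \<Rightarrow> bool" where
  "multigraph G \<longleftrightarrow> finite (verts G) \<and> mult G \<in> nsets (verts G) 2 \<rightarrow>\<^sub>E UNIV"

definition sq_graph :: "nat \<Rightarrow> nat \<Rightarrow> 'a multigraph \<Rightarrow> bool" where
  "sq_graph s q G \<longleftrightarrow>
     multigraph G \<and> (\<forall>X \<in> nsets (verts G) s. (\<Sum>e\<in>nsets X 2. mult G e) \<le> q)"

definition sq_graphs :: "nat \<Rightarrow> nat \<Rightarrow> nat \<Rightarrow> nat multigraph set" where
  "sq_graphs n s q = {G. sq_graph s q G \<and> verts G = {1..n}}"

definition edge_prod :: "'a multigraph \<Rightarrow> nat" where
  "edge_prod G = (\<Prod>e\<in>nsets (verts G) 2. mult G e)"

definition edge_sum :: "'a multigraph \<Rightarrow> nat" where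
  "edge_sum G = (\<Sum>e\<in>nsets (verts G) 2. mult G e)"

text \<open>For \<open>2 \<le> s \<le> n\<close> all multiplicities are at most \<open>q\<close>, so this is the maximum of a finite nonempty
  set. For \<open>2 \<le> n < s\<close> the set is unbounded and the value is meaningless, which does not affect the limit
  below.\<close>

definition ex_Pi_fin :: "nat \<Rightarrow> nat \<Rightarrow> nat \<Rightarrow> nat" where
  "ex_Pi_fin n s q = Max (edge_prod ` sq_graphs n s q)"

definition ex_Pi_seq :: "nat \<Rightarrow> nat \<Rightarrow> nat \<Rightarrow> real" where
  "ex_Pi_seq s q n = real (ex_Pi_fin n s q) powr (1 / real (n choose 2))"

definition ex_Pi :: "nat \<Rightarrow> nat \<Rightarrow> real" where
  "ex_Pi s q = lim (ex_Pi_seq s q)"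

text \<open>The family \<open>T\<^sub>r\<^sub>,\<^sub>1(a,n)\<close> and the number \<open>\<Sigma>\<^sub>r\<^sub>,\<^sub>1(a,n)\<close>, for \<open>a \<ge> 2\<close> and \<open>r \<ge> 1\<close>. The parts \<open>U i\<close>
  may be empty.\<close>

definition T1_graphs :: "nat \<Rightarrow> nat \<Rightarrow> nat \<Rightarrow> nat multigraph set" where
  "T1_graphs r a n = {G. multigraph G \<and> verts G = {1..n} \<and>
     (\<exists>U :: nat \<Rightarrow> nat set.
        disjoint_family_on U {..<r} \<and> (\<Union>i<r. U i) = verts G \<and>
        (\<forall>e \<in> nsets (U 0) 2. mult G e = a - 1) \<and>
        (\<forall>i \<in> {1..<r}. \<forall>e \<in> nsets (U i) 2. mult G e = a) \<and>
        (\<forall>e \<in> nsets (verts G) 2. (\<forall>i<r. \<not> e \<subseteq> U i) \<longrightarrow> mult G e = a + 1))}"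

definition Sigma1 :: "nat \<Rightarrow> nat \<Rightarrow> nat \<Rightarrow> nat" where
  "Sigma1 r a n = Max (edge_sum ` T1_graphs r a n)"

definition x_star1 :: "nat \<Rightarrow> nat \<Rightarrow> real" where
  "x_star1 r a =
     ln ((real a + 1) / real a) / ln ((real a + 1) ^ r / ((real a - 1) ^ (r - 1) * real a))"

end

theory Submission
  imports Defs
begin

text \<open>
  Multiplicities are measured by their shortfall from \<open>a + 1\<close>. In a member of the family
  \<open>T1_graphs\<close> a pair inside part \<open>0\<close> has shortfall \<open>2\<close>, a pair inside another part has
  shortfall \<open>1\<close>, and all other pairs have shortfall \<open>0\<close>. On the logarithmic scale the
  corresponding costs are \<open>gap2\<close>, \<open>gap1\<close> and \<open>0\<close>. If part \<open>0\<close> has weight \<open>wt0\<close> (this is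
  \<open>x_star1\<close>) and each other part has weight \<open>wt1\<close>, then, with part sizes in proportion, a new
  vertex pays the same amount \<open>opt_loss\<close> per old vertex whichever part it joins. This balance drives
  both bounds, and the claimed limit is \<open>opt_rate = (a + 1) exp (- opt_loss)\<close>.

  Lower bound. Put vertices one at a time into the part that costs least. The least cost is at
  most the weighted average, so the total cost on \<open>n\<close> vertices is at most \<open>opt_loss\<close> times the
  number of pairs (\<open>greedy_colouring\<close>), with no error term. The resulting graph satisfies the
  local bound by the very definition of \<open>Sigma1\<close>.

  Upper bound. It suffices to find, in every large \<open>(s, q)\<close>-graph with positive multiplicities, a
  vertex of logarithmic degree at most \<open>ln opt_rate + \<epsilon>\<close> per other vertex; removing such vertices
  one after the other bounds the product. If there is none, then by averaging every small set \<open>X\<close>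
  with positive weights \<open>c\<close> has an outside vertex whose \<open>c\<close>-weighted cost to \<open>X\<close> is less
  than \<open>opt_loss\<close> times the total weight. The locale \<open>rich_multigraph\<close> collects these properties,
  and \<open>impossible\<close> refutes them. For large \<open>a\<close> one has
  \<open>(a + 1) opt_loss \<approx> 2 / (2 r - 1)\<close>, so for small integer weights the extension property becomes
  an inequality between integers: the weighted shortfall is at most \<open>2 / (2 r - 1)\<close> times the total
  weight (\<open>extend_linear\<close>).

  With all weights equal, every \<open>t\<close>-set has an extension by one vertex that raises the total
  shortfall by at most \<open>\<lfloor>2 t / (2 r - 1)\<rfloor>\<close>. These are exactly the increments of the smallest total shortfall
  \<open>deficit\<close> of a member of \<open>T1_graphs\<close>. Hence a \<open>t\<close>-set whose shortfall is too small could be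
  extended to an \<open>s\<close>-set whose shortfall is too small, and therefore every set of at most \<open>s\<close>
  vertices satisfies the corresponding bound (\<open>deficit_le_total\<close>). This replaces \<open>s\<close> by the three
  sizes \<open>2\<close>, \<open>r + 1\<close> and \<open>2 r\<close>: no shortfall is negative, no \<open>r + 1\<close> vertices have all
  shortfalls \<open>0\<close>, and \<open>2 r\<close> vertices have total shortfall at least \<open>r + 1\<close>.

  The contradiction comes from repeated extension. Equal weights give \<open>r\<close> vertices at mutual
  shortfall \<open>0\<close>, then twins of \<open>r - 1\<close> of them (\<open>doubled_exists\<close>). The exact weights
  \<open>wt0\<close> on the untwinned vertex and \<open>wt1 / 2\<close> on the others force the next vertex to turn the
  untwinned vertex and one pair of twins into a path of shortfalls \<open>1\<close> on four vertices
  (\<open>path_exists\<close>); suitable integer weights then force this path to close to a five-cycle, and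
  a last extension of the five-cycle contradicts the bound for \<open>2 r\<close>-sets.
\<close>

section \<open>Colourings and their cost\<close>

lemma sum_nsets_insert:
  fixes f :: "'a set \<Rightarrow> 'b::comm_monoid_add"
  assumes "finite V" "v \<notin> V"
  shows "(\<Sum>e\<in>nsets (insert v V) 2. f e) = (\<Sum>e\<in>nsets V 2. f e) + (\<Sum>u\<in>V. f {u, v})"
proof -
  have "nsets (insert v V) 2 = nsets V 2 \<union> (\<lambda>u. {u, v}) ` V" (is "?L = ?R")
  proof
    show "?L \<subseteq> ?R"
    proof
      fix e assume "e \<in> ?L"
      then obtain x y where e: "e = {x, y}" "x \<noteq> y" "x \<in> insert v V" "y \<in> insert v V"
        by (auto simp: nsets_2_eq)
      then show "e \<in> ?R" by (auto simp: nsets_2_eq insert_commute)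
    qed
    show "?R \<subseteq> ?L" using assms by (auto simp: nsets_def card_insert_if)
  qed
  moreover have "nsets V 2 \<inter> (\<lambda>u. {u, v}) ` V = {}"
    using assms by (auto simp: nsets_def)
  moreover have "inj_on (\<lambda>u. {u, v}) V"
    using assms by (auto simp: inj_on_def doubleton_eq_iff)
  moreover have "finite (nsets V 2)" using assms by (simp add: finite_imp_finite_nsets)
  ultimately show ?thesis
    using assms by (simp add: sum.union_disjoint sum.reindex)
qed

text \<open>The smallest total shortfall of a member of \<open>T1_graphs\<close> on \<open>n\<close> vertices. The balanced part
  sizes are in ratio \<open>1 : 2 : \<dots> : 2\<close>, and \<open>\<lfloor>2 t / (2 r - 1)\<rfloor>\<close> is the cheapest cost of adding
  a vertex to \<open>t\<close> balanced ones.\<close>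

definition deficit :: "nat \<Rightarrow> nat \<Rightarrow> nat" where
  "deficit r n = (\<Sum>t<n. 2 * t div (2 * r - 1))"

lemma deficit_Suc: "deficit r (Suc n) = deficit r n + 2 * n div (2 * r - 1)"
  by (simp add: deficit_def)

lemma deficit_small:
  assumes "n \<le> r"
  shows "deficit r n = 0"
proof -
  have "2 * t div (2 * r - 1) = 0" if "t < n" for t
    using that assms by (intro div_less) simp
  then show ?thesis by (simp add: deficit_def)
qed

lemma deficit_middle:
  assumes "r + j < 2 * r"
  shows "deficit r (r + j) = j"
  using assms
proof (induction j)
  case 0
  then show ?case by (simp add: deficit_small)
next
  case (Suc j)
  have "2 * (r + j) div (2 * r - 1) = 1"
    using Suc.prems by (intro div_nat_eqI) auto
  then show ?case using Suc by (simp add: deficit_Suc)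
qed

lemma deficit_double:
  assumes "r \<ge> 1"
  shows "deficit r (2 * r) = r + 1"
proof -
  have eq: "2 * r = Suc (r + (r - 1))" using assms by simp
  have "2 * (r + (r - 1)) div (2 * r - 1) = 2" using assms by (intro div_nat_eqI) auto
  moreover have "deficit r (r + (r - 1)) = r - 1" using assms by (intro deficit_middle) simp
  ultimately show ?thesis unfolding eq deficit_Suc using assms by (simp add: mult_2)
qed

text \<open>The cost of a pair under a colouring: \<open>L i\<close> if both ends have colour \<open>i\<close>, and \<open>0\<close> if the
  colours differ. It is defined on sets because multiplicities are.\<close>

definition loss :: "(nat \<Rightarrow> 'b::zero) \<Rightarrow> ('a \<Rightarrow> nat) \<Rightarrow> 'a set \<Rightarrow> 'b" where
  "loss L f e = (if is_singleton (f ` e) then L (the_elem (f ` e)) else 0)"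

lemma loss_pair: "loss L f {u, v} = (if f u = f v then L (f v) else 0)"
  by (auto simp: loss_def is_singleton_def doubleton_eq_iff)

lemma loss_compose: "loss L f (g ` e) = loss L (f \<circ> g) e"
  by (simp add: loss_def image_comp)

abbreviation unit_loss :: "nat \<Rightarrow> nat" where
  "unit_loss i \<equiv> (if i = 0 then 2 else 1)"

lemma sum_loss_vertex:
  fixes L :: "nat \<Rightarrow> 'b::comm_semiring_1"
  assumes "finite V"
  shows "(\<Sum>u\<in>V. loss L f {u, v}) = L (f v) * of_nat (card {u \<in> V. f u = f v})"
proof -
  have "(\<Sum>u\<in>V. loss L f {u, v}) = (\<Sum>u\<in>{u \<in> V. f u = f v}. L (f v))"
    using assms by (simp add: loss_pair sum.If_cases Int_def)
  then show ?thesis by (simp add: mult.commute)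
qed

lemma card_by_colour:
  fixes f :: "'a \<Rightarrow> nat"
  assumes "finite V" "f ` V \<subseteq> {..<r}"
  shows "card V = (\<Sum>i<r. card {u \<in> V. f u = i})"
proof -
  have "(\<Sum>i<r. card {u \<in> V. f u = i}) = (\<Sum>i<r. \<Sum>u\<in>{u \<in> V. f u = i}. 1)" by simp
  also have "\<dots> = (\<Sum>u\<in>V. 1)"
    by (rule sum.group) (use assms in auto)
  finally show ?thesis by simp
qed

text \<open>Remove a vertex of a colour class where removal saves most. If every nonempty class saved less than
  \<open>M = \<lfloor>2 n / (2 r - 1)\<rfloor>\<close>, then class \<open>0\<close> would have at most \<open>(M + 1) / 2\<close> vertices and every
  other class at most \<open>M\<close>, which is too few for \<open>n + 1\<close> vertices.\<close>

lemma deficit_le_loss: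
  assumes "finite V" "f ` V \<subseteq> {..<r}" "r \<ge> 1"
  shows "deficit r (card V) \<le> (\<Sum>e\<in>nsets V 2. loss unit_loss f e)"
  using assms
proof (induction "card V" arbitrary: V)
  case 0
  then show ?case by (simp add: deficit_def)
next
  case (Suc n)
  define M where "M = 2 * n div (2 * r - 1)"
  define c where "c i = card {u \<in> V. f u = i}" for i
  have "\<exists>i<r. c i > 0 \<and> unit_loss i * (c i - 1) \<ge> M"
  proof (rule ccontr)
    assume "\<not> ?thesis"
    then have small: "unit_loss i * (c i - 1) < M" if "i < r" "c i > 0" for i
      using that by (meson not_le)
    have c0: "2 * c 0 \<le> M + 1" using small[of 0] Suc.prems(3) by (cases "c 0 = 0") auto
    have ci: "c i \<le> M" if "i < r" "i \<noteq> 0" for i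
      using small[of i] that by (cases "c i = 0") auto
    have "card V = c 0 + (\<Sum>i\<in>{..<r} - {0}. c i)"
      using card_by_colour[OF Suc.prems(1,2)] Suc.prems(3)
      by (subst sum.remove[symmetric]) (auto simp: c_def)
    also have "\<dots> \<le> c 0 + (\<Sum>i\<in>{..<r} - {0}. M)"
      using ci by (intro add_left_mono sum_mono) auto
    also have "(\<Sum>i\<in>{..<r} - {0}. M) = (r - 1) * M" using Suc.prems(3) by simp
    finally have total: "card V \<le> c 0 + (r - 1) * M" .
    have "2 * Suc n \<le> M + 1 + 2 * ((r - 1) * M)" using c0 mult_le_mono2[OF total, of 2]
      unfolding Suc.hyps(2)[symmetric] distrib_left by (rule_tac le_trans) auto
    also have "\<dots> = M * (2 * r - 1) + 1"
      using Suc.prems(3) by (cases r) (auto simp: algebra_simps)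
    also have "M * (2 * r - 1) \<le> 2 * n" unfolding M_def by (rule div_times_less_eq_dividend)
    finally show False by simp
  qed
  then obtain i where i: "i < r" "c i > 0" "unit_loss i * (c i - 1) \<ge> M" by blast
  then obtain v where v: "v \<in> V" "f v = i" unfolding c_def by (auto simp: card_gt_0_iff)
  define W where "W = V - {v}"
  have W: "finite W" "v \<notin> W" "V = insert v W" "card W = n"
    using Suc.prems Suc.hyps(2) v by (auto simp: W_def)
  have "{u \<in> W. f u = i} = {u \<in> V. f u = i} - {v}" by (auto simp: W_def)
  then have "card {u \<in> W. f u = i} = c i - 1" using v Suc.prems(1) by (simp add: c_def)
  then have "M \<le> (\<Sum>u\<in>W. loss unit_loss f {u, v})"
    using i v sum_loss_vertex[OF W(1), of unit_loss f v] by simp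
  moreover have "deficit r n \<le> (\<Sum>e\<in>nsets W 2. loss unit_loss f e)"
    using Suc.hyps(1)[of W] W Suc.prems by auto
  ultimately show ?case
    using W by (simp add: sum_nsets_insert deficit_Suc M_def Suc.hyps(2)[symmetric])
qed

text \<open>When \<open>p i * L i\<close> does not depend on \<open>i\<close>, the \<open>p\<close>-average over \<open>i\<close> of the cost of giving
  colour \<open>i\<close> to a new vertex is \<open>\<Lambda> * n\<close> for every colouring of the first \<open>n\<close> vertices. Some
  colour does at least as well as the average.\<close>

lemma greedy_colouring:
  fixes L p :: "nat \<Rightarrow> real"
  assumes "\<And>i. i < r \<Longrightarrow> p i \<ge> 0" "(\<Sum>i<r. p i) = 1" "\<And>i. i < r \<Longrightarrow> p i * L i = \<Lambda>"
  shows "\<exists>f. (\<forall>v. f v < r) \<and> (\<Sum>e\<in>nsets {1..n} 2. loss L f e) \<le> \<Lambda> * real (n choose 2)"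
proof (induction n)
  case 0
  have "r > 0" using assms(2) by (cases r) auto
  moreover have "nsets {1..0::nat} 2 = {}" by (auto simp: nsets_def)
  ultimately show ?case by (intro exI[of _ "\<lambda>_. 0"]) (simp add: numeral_2_eq_2)
next
  case (Suc n)
  then obtain f where f: "\<And>v. f v < r"
    "(\<Sum>e\<in>nsets {1..n} 2. loss L f e) \<le> \<Lambda> * real (n choose 2)" by blast
  define c where "c i = card {u \<in> {1..n}. f u = i}" for i
  have "\<exists>i<r. L i * c i \<le> \<Lambda> * n"
  proof (rule ccontr)
    assume "\<not> ?thesis"
    then have big: "\<Lambda> * n < L i * c i" if "i < r" for i using that by auto
    have "\<exists>i<r. p i > 0"
    proof (rule ccontr)
      assume "\<not> ?thesis"
      then have "(\<Sum>i<r. p i) \<le> 0" by (intro sum_nonpos) (meson lessThan_iff not_less)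
      then show False using assms(2) by simp
    qed
    then obtain k where k: "k < r" "p k > 0" by blast
    have "\<Lambda> * n = (\<Sum>i<r. p i * (\<Lambda> * n))"
      by (simp add: sum_distrib_right[symmetric] assms(2))
    also have "\<dots> < (\<Sum>i<r. p i * (L i * c i))"
    proof (rule sum_strict_mono_ex1)
      show "\<forall>i\<in>{..<r}. p i * (\<Lambda> * n) \<le> p i * (L i * c i)"
        using big assms(1) by (intro ballI mult_left_mono) (auto intro: less_imp_le)
      show "\<exists>i\<in>{..<r}. p i * (\<Lambda> * n) < p i * (L i * c i)"
        using k big[of k] by (intro bexI[of _ k]) auto
    qed simp
    also have "\<dots> = (\<Sum>i<r. \<Lambda> * c i)"
      using assms(3) by (intro sum.cong) (auto simp: mult.assoc[symmetric])
    also have "\<dots> = \<Lambda> * real (\<Sum>i<r. c i)" by (simp add: sum_distrib_left)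
    also have "(\<Sum>i<r. c i) = n"
      using card_by_colour[of "{1..n}" f r] f(1) by (simp add: c_def image_subset_iff)
    finally show False by simp
  qed
  then obtain i where i: "i < r" "L i * c i \<le> \<Lambda> * n" by blast
  define g where "g = f(Suc n := i)"
  have old: "(\<Sum>e\<in>nsets {1..n} 2. loss L g e) = (\<Sum>e\<in>nsets {1..n} 2. loss L f e)"
  proof (rule sum.cong)
    fix e assume "e \<in> nsets {1..n} 2"
    then have "e \<subseteq> {1..n}" by (simp add: nsets_def)
    then have "g ` e = f ` e" by (auto simp: g_def intro!: image_cong)
    then show "loss L g e = loss L f e" by (simp add: loss_def)
  qed simp
  have "{u \<in> {1..n}. g u = g (Suc n)} = {u \<in> {1..n}. f u = i}" by (auto simp: g_def)
  then have new: "(\<Sum>u\<in>{1..n}. loss L g {u, Suc n}) = L i * c i"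
    by (subst sum_loss_vertex) (auto simp: c_def g_def)
  have "{1..Suc n} = insert (Suc n) {1..n}" by auto
  then have "(\<Sum>e\<in>nsets {1..Suc n} 2. loss L g e)
      = (\<Sum>e\<in>nsets {1..n} 2. loss L f e) + L i * c i"
    using sum_nsets_insert[of "{1..n}" "Suc n" "loss L g"] old new by simp
  also have "\<dots> \<le> \<Lambda> * real (n choose 2) + \<Lambda> * n" using f(2) i(2) by linarith
  also have "\<dots> = \<Lambda> * real (Suc n choose 2)"
    by (simp add: numeral_2_eq_2 algebra_simps)
  finally have "(\<Sum>e\<in>nsets {1..Suc n} 2. loss L g e) \<le> \<Lambda> * real (Suc n choose 2)" .
  moreover have "\<forall>v. g v < r" using f(1) i(1) by (simp add: g_def)
  ultimately show ?case by blast
qed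

section \<open>The optimal logarithmic cost\<close>

text \<open>The weights \<open>wt0\<close> (part \<open>0\<close>) and \<open>wt1\<close> (each other part) solve
  \<open>wt0 * gap2 = wt1 * gap1\<close> and \<open>wt0 + (r - 1) * wt1 = 1\<close>, and \<open>opt_loss\<close> is the common product.\<close>

definition gap1 :: "nat \<Rightarrow> real" where "gap1 a = ln ((real a + 1) / real a)"
definition gap2 :: "nat \<Rightarrow> real" where "gap2 a = ln ((real a + 1) / (real a - 1))"
definition wt0 :: "nat \<Rightarrow> nat \<Rightarrow> real" where
  "wt0 r a = gap1 a / ((real r - 1) * gap2 a + gap1 a)"
definition wt1 :: "nat \<Rightarrow> nat \<Rightarrow> real" where
  "wt1 r a = gap2 a / ((real r - 1) * gap2 a + gap1 a)"
definition opt_loss :: "nat \<Rightarrow> nat \<Rightarrow> real" where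
  "opt_loss r a = gap1 a * gap2 a / ((real r - 1) * gap2 a + gap1 a)"

definition opt_rate :: "nat \<Rightarrow> nat \<Rightarrow> real" where
  "opt_rate r a = (real a + 1) * exp (- opt_loss r a)"

context
  fixes r a :: nat
  assumes r: "r \<ge> 2" and a: "a \<ge> 2"
begin

lemma gap1_pos: "gap1 a > 0" using a by (simp add: gap1_def)

lemma gap2_ge: "2 * gap1 a \<le> gap2 a"
proof -
  have "2 * gap1 a = ln (((real a + 1) / real a)\<^sup>2)"
    using a by (simp add: gap1_def ln_realpow)
  also have "\<dots> \<le> gap2 a" unfolding gap2_def
  proof (subst ln_le_cancel_iff)
    show "((real a + 1) / real a)\<^sup>2 \<le> (real a + 1) / (real a - 1)"
      using a by (simp add: field_simps power2_eq_square)
  qed (use a in auto)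
  finally show ?thesis .
qed

lemma gap2_pos: "gap2 a > 0" using gap1_pos gap2_ge by linarith

lemma gap_denominator_pos: "(real r - 1) * gap2 a + gap1 a > 0"
  using r gap1_pos gap2_pos by (intro add_nonneg_pos mult_nonneg_nonneg) auto

lemma wt0_pos: "wt0 r a > 0" using gap1_pos gap_denominator_pos by (simp add: wt0_def)

lemma wt1_pos: "wt1 r a > 0" using gap2_pos gap_denominator_pos by (simp add: wt1_def)

lemma wt_sum: "wt0 r a + (real r - 1) * wt1 r a = 1"
proof -
  have "wt0 r a + (real r - 1) * wt1 r a
      = (gap1 a + (real r - 1) * gap2 a) / ((real r - 1) * gap2 a + gap1 a)"
    by (simp add: wt0_def wt1_def add_divide_distrib)
  then show ?thesis using gap_denominator_pos by (simp add: add.commute)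
qed

lemma wt0_gap2: "wt0 r a * gap2 a = opt_loss r a" by (simp add: wt0_def opt_loss_def)

lemma wt1_gap1: "wt1 r a * gap1 a = opt_loss r a"
  by (simp add: wt1_def opt_loss_def mult.commute)

lemma opt_loss_pos: "opt_loss r a > 0"
  using wt0_pos gap2_pos wt0_gap2 by (metis mult_pos_pos)

lemma opt_loss_le_gap1: "opt_loss r a \<le> gap1 a"
proof -
  have "wt1 r a \<le> (real r - 1) * wt1 r a" using r wt1_pos by simp
  then have "wt1 r a \<le> 1" using wt_sum wt0_pos by linarith
  then show ?thesis using wt1_gap1 gap1_pos by (metis mult_left_le_one_le less_imp_le wt1_pos)
qed

text \<open>The reciprocal of \<open>opt_loss\<close> is \<open>(r - 1) / gap1 a + 1 / gap2 a\<close>, and \<open>ln (1 + x) \<le> x\<close> bounds each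
  summand from below.\<close>

lemma opt_loss_upper: "opt_loss r a \<le> 2 / ((2 * real r - 1) * real a - 1)"
proof -
  have "gap1 a = ln (1 + 1 / real a)" using a by (simp add: gap1_def field_simps)
  also have "\<dots> \<le> 1 / real a" using a by (intro ln_add_one_self_le_self) simp
  finally have g1: "real a \<le> 1 / gap1 a" using gap1_pos a by (simp add: field_simps)
  have "gap2 a = ln (1 + 2 / (real a - 1))" using a by (simp add: gap2_def field_simps)
  also have "\<dots> \<le> 2 / (real a - 1)" using a by (intro ln_add_one_self_le_self) simp
  finally have g2: "(real a - 1) / 2 \<le> 1 / gap2 a" using gap2_pos a by (simp add: field_simps)
  have "((2 * real r - 1) * real a - 1) / 2 = (real r - 1) * real a + (real a - 1) / 2"
    by (simp add: field_simps)
  also have "\<dots> \<le> (real r - 1) * (1 / gap1 a) + 1 / gap2 a"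
    using r g1 g2 by (intro add_mono mult_left_mono) auto
  also have "\<dots> = 1 / opt_loss r a"
    using gap1_pos gap2_pos by (simp add: opt_loss_def add_divide_distrib)
  finally have "((2 * real r - 1) * real a - 1) * opt_loss r a \<le> 2"
    using opt_loss_pos by (simp add: field_simps)
  moreover have "(2 * real r - 1) * real a > 1"
    using mult_mono[of 2 "2 * real r - 1" 1 "real a"] r a by simp
  ultimately show ?thesis by (simp add: pos_le_divide_eq mult.commute)
qed

lemma x_star1_eq: "x_star1 r a = wt0 r a"
proof -
  have "ln ((real a + 1) ^ r / ((real a - 1) ^ (r - 1) * real a))
      = real r * ln (real a + 1) - (real r - 1) * ln (real a - 1) - ln (real a)"
    using a r by (simp add: ln_div ln_mult ln_realpow of_nat_diff)
  also have "\<dots> = (real r - 1) * gap2 a + gap1 a"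
    using a by (simp add: gap1_def gap2_def ln_div algebra_simps)
  finally show ?thesis by (simp add: x_star1_def wt0_def gap1_def)
qed

lemma opt_rate_eq: "(real a + 1) powr ((real r - 2 + x_star1 r a) / (real r - 1)) *
       real a powr ((1 - x_star1 r a) / (real r - 1)) = opt_rate r a"
proof -
  have w: "(1 - wt0 r a) / (real r - 1) = wt1 r a"
    using wt_sum r by (simp add: field_simps)
  have "(real r - 2 + wt0 r a) / (real r - 1) = 1 - (1 - wt0 r a) / (real r - 1)"
    using r by (simp add: field_simps)
  then have w': "(real r - 2 + wt0 r a) / (real r - 1) = 1 - wt1 r a" using w by simp
  have "(real a + 1) powr (1 - wt1 r a) * real a powr wt1 r a
      = exp ((1 - wt1 r a) * ln (real a + 1) + wt1 r a * ln (real a))"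
    using a by (simp add: powr_def exp_add)
  also have "(1 - wt1 r a) * ln (real a + 1) + wt1 r a * ln (real a)
      = ln (real a + 1) - wt1 r a * gap1 a"
    using a by (simp add: gap1_def ln_div algebra_simps)
  finally show ?thesis
    using a unfolding x_star1_eq w w' wt1_gap1 opt_rate_def
    by (simp add: exp_diff exp_minus divide_inverse)
qed

end

lemma sum_colours_weights:
  fixes r :: nat
  assumes "r \<ge> 2"
  shows "(\<Sum>i<r. if i = 0 then x else y :: real) = x + (real r - 1) * y"
proof -
  have "(\<Sum>i<r. if i = 0 then x else y) = x + (\<Sum>i\<in>{..<r} - {0}. if i = 0 then x else y)"
    using assms by (subst sum.remove[of _ 0]) auto
  also have "(\<Sum>i\<in>{..<r} - {0}. if i = 0 then x else y) = (\<Sum>i\<in>{..<r} - {0}. y)"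
    by (intro sum.cong) auto
  finally show ?thesis using assms by (simp add: of_nat_diff)
qed

lemma ln_opt_rate:
  assumes "r \<ge> 2" "a \<ge> 2"
  shows "ln (opt_rate r a) = ln (real a + 1) - opt_loss r a" "0 \<le> ln (opt_rate r a)"
proof -
  show eq: "ln (opt_rate r a) = ln (real a + 1) - opt_loss r a"
    by (simp add: opt_rate_def ln_mult add_nonneg_pos)
  have "gap1 a = ln (real a + 1) - ln (real a)" using assms by (simp add: gap1_def ln_div)
  moreover have "0 \<le> ln (real a)" using assms by simp
  ultimately show "0 \<le> ln (opt_rate r a)" using opt_loss_le_gap1[OF assms] eq by linarith
qed

section \<open>Multigraphs in which every vertex has large degree\<close>

text \<open>The situation to be refuted. The assumption \<open>deficit_s\<close> is the bound on \<open>s\<close>-sets in terms of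
  shortfalls, and \<open>extend\<close> is what averaging gives when all logarithmic degrees are too large.
  Sets of up to \<open>s + 1\<close> vertices are needed because the last extension starts from \<open>2 r + 1\<close>
  vertices.\<close>

locale rich_multigraph =
  fixes V :: "'a set" and w :: "'a set \<Rightarrow> nat" and r s a :: nat
  assumes r: "r \<ge> 2" and s: "s \<ge> 2 * r" and a: "a \<ge> 12 * (s + 1)"
    and nonempty: "V \<noteq> {}"
    and pos: "\<And>e. e \<in> nsets V 2 \<Longrightarrow> 0 < w e"
    and deficit_s: "\<And>X. X \<in> nsets V s \<Longrightarrow>
      int (deficit r s) \<le> (\<Sum>e\<in>nsets X 2. int a + 1 - int (w e))"
    and extend: "\<And>X c. \<lbrakk>X \<subseteq> V; X \<noteq> {}; finite X; card X \<le> s + 1; \<And>x. x \<in> X \<Longrightarrow> 0 < c x\<rbrakk> \<Longrightarrow>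
      \<exists>v\<in>V - X. (\<Sum>x\<in>X. c x * ln ((real a + 1) / real (w {x, v}))) < opt_loss r a * (\<Sum>x\<in>X. c x)"
begin

text \<open>The shortfall of a pair, an integer because it is not yet known to be nonnegative.\<close>

definition D :: "'a \<Rightarrow> 'a \<Rightarrow> int" where
  "D x y = int a + 1 - int (w {x, y})"

definition total :: "'a set \<Rightarrow> int" where
  "total X = (\<Sum>e\<in>nsets X 2. int a + 1 - int (w e))"

lemma D_commute: "D x y = D y x"
  by (simp add: D_def insert_commute)

lemma total_insert:
  "finite X \<Longrightarrow> v \<notin> X \<Longrightarrow> total (insert v X) = total X + (\<Sum>x\<in>X. D x v)"
  by (simp add: total_def D_def sum_nsets_insert)

lemma log_loss_ge:
  assumes "x \<in> V" "v \<in> V" "x \<noteq> v"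
  shows "real_of_int (D x v) \<le> (real a + 1) * ln ((real a + 1) / real (w {x, v}))"
proof -
  have p: "real (w {x, v}) > 0" using pos[of "{x, v}"] assms by (auto simp: nsets_def)
  have "ln (real (w {x, v}) / (real a + 1)) \<le> real (w {x, v}) / (real a + 1) - 1"
    using p by (intro ln_le_minus_one) simp
  then have "(real a + 1) * ln (real (w {x, v}) / (real a + 1)) \<le> real (w {x, v}) - (real a + 1)"
    by (simp add: field_simps)
  moreover have "ln ((real a + 1) / real (w {x, v})) = - ln (real (w {x, v}) / (real a + 1))"
    using p by (simp add: ln_div)
  ultimately show ?thesis by (simp add: D_def)
qed

text \<open>Since \<open>ln x \<le> x - 1\<close>, the shortfall is at most \<open>a + 1\<close> times the logarithmic cost. The error in
  \<open>(a + 1) opt_loss \<approx> 2 / (2 r - 1)\<close> is so small for \<open>a \<ge> 12 (s + 1)\<close> that, with weights at most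
  \<open>3\<close>, it raises the right-hand side by at most \<open>1\<close>, and a strict inequality between integers absorbs
  that.\<close>

lemma extend_linear:
  fixes c :: "'a \<Rightarrow> nat"
  assumes X: "X \<subseteq> V" "finite X" "card X \<le> s + 1" and c: "\<And>x. x \<in> X \<Longrightarrow> 0 < c x \<and> c x \<le> 3"
  shows "\<exists>v\<in>V - X. (2 * int r - 1) * (\<Sum>x\<in>X. int (c x) * D x v) \<le> 2 * (\<Sum>x\<in>X. int (c x))"
proof (cases "X = {}")
  case True
  then show ?thesis using nonempty by auto
next
  case False
  define C where "C = (\<Sum>x\<in>X. real (c x))"
  define R where "R = 2 * real r - 1"
  obtain v where v: "v \<in> V - X"
    "(\<Sum>x\<in>X. real (c x) * ln ((real a + 1) / real (w {x, v}))) < opt_loss r a * C"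
    using extend[OF X(1) False X(2,3), of "\<lambda>x. real (c x)"] c by (auto simp: C_def)
  define S where "S = (\<Sum>x\<in>X. real (c x) * real_of_int (D x v))"
  have "S \<le> (\<Sum>x\<in>X. real (c x) * ((real a + 1) * ln ((real a + 1) / real (w {x, v}))))"
    unfolding S_def using v X by (intro sum_mono mult_left_mono log_loss_ge) auto
  also have "\<dots> = (real a + 1) * (\<Sum>x\<in>X. real (c x) * ln ((real a + 1) / real (w {x, v})))"
    by (simp add: sum_distrib_left mult.left_commute)
  also have "\<dots> < (real a + 1) * (opt_loss r a * C)"
    using v(2) by (intro mult_strict_left_mono) auto
  finally have S: "S < (real a + 1) * opt_loss r a * C" by simp
  have C0: "0 \<le> C" by (simp add: C_def sum_nonneg)
  have "C \<le> (\<Sum>x\<in>X. 3)" unfolding C_def using c by (intro sum_mono) fastforce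
  also have "\<dots> \<le> 3 * (real s + 1)" using X(3) by simp
  finally have C: "C \<le> 3 * (real s + 1)" .
  have R: "R \<ge> real r + 1" using r by (simp add: R_def)
  have a': "real a \<ge> 12 * (real s + 1)" using a by (simp flip: of_nat_le_iff)
  have "(real r + 1) * real a \<le> R * real a" using R by (intro mult_right_mono) auto
  then have Ra: "real r * real a \<le> R * real a - 1" using a' by (simp add: algebra_simps)
  have rs: "0 < real r * real a" using r a by simp
  have "R * ((real a + 1) * opt_loss r a * C) \<le> R * ((real a + 1) * (2 / (R * real a - 1)) * C)"
    using opt_loss_upper[of r a] r a C0 R unfolding R_def
    by (intro mult_left_mono mult_right_mono) auto
  also have "\<dots> = 2 * C + 2 * (R + 1) * C / (R * real a - 1)"
    using Ra rs by (simp add: field_simps)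
  also have "2 * (R + 1) * C / (R * real a - 1) \<le> 1"
  proof -
    have "2 * (R + 1) * C = 4 * real r * C" by (simp add: R_def)
    also have "\<dots> \<le> 4 * real r * (3 * (real s + 1))" using C by (intro mult_left_mono) auto
    also have "\<dots> = real r * (12 * (real s + 1))" by simp
    also have "\<dots> \<le> real r * real a" using a' by (intro mult_left_mono) auto
    finally show ?thesis using Ra rs by simp
  qed
  finally have "R * ((real a + 1) * opt_loss r a * C) \<le> 2 * C + 1" by simp
  moreover have "R * S < R * ((real a + 1) * opt_loss r a * C)"
    using S R by (intro mult_strict_left_mono) auto
  ultimately have "R * S < 2 * C + 1" by linarith
  then have "real_of_int ((2 * int r - 1) * (\<Sum>x\<in>X. int (c x) * D x v))
      < real_of_int (2 * (\<Sum>x\<in>X. int (c x)) + 1)"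
    by (simp add: R_def S_def C_def)
  then have "(2 * int r - 1) * (\<Sum>x\<in>X. int (c x) * D x v) < 2 * (\<Sum>x\<in>X. int (c x)) + 1"
    by (simp only: of_int_less_iff)
  then show ?thesis using v(1) by (intro bexI[of _ v]) auto
qed

lemma extend_uniform:
  assumes X: "X \<subseteq> V" "finite X" "card X \<le> s + 1"
  shows "\<exists>v\<in>V - X. (\<Sum>x\<in>X. D x v) \<le> int (2 * card X div (2 * r - 1))"
proof -
  obtain v where v: "v \<in> V - X" "(2 * int r - 1) * (\<Sum>x\<in>X. D x v) \<le> 2 * int (card X)"
    using extend_linear[OF X, of "\<lambda>_. 1"] by auto
  have "(\<Sum>x\<in>X. D x v) = ((2 * int r - 1) * (\<Sum>x\<in>X. D x v)) div (2 * int r - 1)"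
    using r by simp
  also have "\<dots> \<le> (2 * int (card X)) div (2 * int r - 1)"
    using v(2) r by (intro zdiv_mono1) auto
  also have "\<dots> = int (2 * card X div (2 * r - 1))"
    using r by (simp add: zdiv_int of_nat_diff)
  finally show ?thesis using v(1) by blast
qed

text \<open>Downward induction on the size: a set with too small a total would, by \<open>extend_uniform\<close>,
  extend to a set with one more vertex and too small a total, contradicting the bound for that
  size.\<close>

lemma deficit_le_total:
  assumes "X \<subseteq> V" "finite X" "card X \<le> s"
  shows "int (deficit r (card X)) \<le> total X"
  using assms
proof (induction "s - card X" arbitrary: X)
  case 0
  then show ?case using deficit_s[of X] by (auto simp: total_def nsets_def)
next
  case (Suc n)
  obtain v where v: "v \<in> V - X" "(\<Sum>x\<in>X. D x v) \<le> int (2 * card X div (2 * r - 1))"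
    using extend_uniform[of X] Suc.prems by auto
  have "int (deficit r (card (insert v X))) \<le> total (insert v X)"
    using Suc.hyps(2) Suc.prems v(1) by (intro Suc.hyps(1)) auto
  then show ?case using v Suc.prems by (simp add: total_insert deficit_Suc)
qed

lemma D_nonneg:
  assumes "x \<in> V" "y \<in> V" "x \<noteq> y"
  shows "0 \<le> D x y"
proof -
  have "total {y} = 0" unfolding total_def by (intro sum.neutral) (auto simp: nsets_2_eq)
  then have "total {x, y} = D x y" using assms by (simp add: total_insert D_commute)
  moreover have "int (deficit r (card {x, y})) \<le> total {x, y}"
    using assms r s by (intro deficit_le_total) auto
  ultimately show ?thesis by linarith
qed

lemma total_double:
  assumes "X \<subseteq> V" "finite X" "card X = 2 * r"
  shows "int r + 1 \<le> total X"
  using deficit_le_total[OF assms(1,2)] assms(3) s deficit_double[of r] r by simp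

text \<open>Otherwise \<open>v\<close> has shortfall \<open>0\<close> to some vertex of each colour, and together these are \<open>r + 1\<close>
  vertices with all mutual shortfalls \<open>0\<close>.\<close>

lemma full_colour_class:
  assumes X: "X \<subseteq> V" "finite X" "\<phi> ` X = {..<r}"
    and cross: "\<And>x y. x \<in> X \<Longrightarrow> y \<in> X \<Longrightarrow> \<phi> x \<noteq> \<phi> y \<Longrightarrow> D x y = 0"
    and v: "v \<in> V - X"
  shows "\<exists>i<r. \<forall>x\<in>X. \<phi> x = i \<longrightarrow> 1 \<le> D x v"
proof (rule ccontr)
  assume "\<not> ?thesis"
  then have "\<forall>i\<in>{..<r}. \<exists>x\<in>X. \<phi> x = i \<and> \<not> 1 \<le> D x v" by auto
  then obtain g where g: "\<And>i. i < r \<Longrightarrow> g i \<in> X" "\<And>i. i < r \<Longrightarrow> \<phi> (g i) = i"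
    "\<And>i. i < r \<Longrightarrow> \<not> 1 \<le> D (g i) v" by (metis lessThan_iff)
  have zero: "D (g i) v = 0" if "i < r" for i
    using D_nonneg[of "g i" v] g(1,3)[OF that] X v by fastforce
  define K where "K = g ` {..<r}"
  have "inj_on g {..<r}" using g(2) by (metis inj_onI lessThan_iff)
  then have K: "K \<subseteq> X" "finite K" "card K = r" using g(1) by (auto simp: K_def card_image)
  have "total K = 0"
    unfolding total_def
  proof (rule sum.neutral, rule ballI)
    fix e assume "e \<in> nsets K 2"
    then obtain i j where ij: "e = {g i, g j}" "g i \<noteq> g j" "i < r" "j < r"
      by (auto simp: nsets_2_eq K_def)
    then have "D (g i) (g j) = 0" using cross[of "g i" "g j"] g by auto
    then show "int a + 1 - int (w e) = 0" by (simp add: D_def ij(1))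
  qed
  moreover have "(\<Sum>x\<in>K. D x v) = 0" using zero by (intro sum.neutral) (auto simp: K_def)
  moreover have "v \<notin> K" using v K by auto
  ultimately have "total (insert v K) = 0" using K by (simp add: total_insert)
  moreover have "int (deficit r (card (insert v K))) \<le> total (insert v K)"
    using K v X s r by (intro deficit_le_total) (auto simp: card_insert_if)
  moreover have "card (insert v K) = r + 1" using K \<open>v \<notin> K\<close> by simp
  moreover have "deficit r (r + 1) = 1" using r by (intro deficit_middle) simp
  ultimately show False by simp
qed

lemma clique_exists:
  assumes "t \<le> r"
  shows "\<exists>X. X \<subseteq> V \<and> finite X \<and> card X = t \<and> (\<forall>x\<in>X. \<forall>y\<in>X. x \<noteq> y \<longrightarrow> D x y = 0)"
  using assms
proof (induction t)
  case 0
  then show ?case by (intro exI[of _ "{}"]) auto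
next
  case (Suc t)
  then obtain X where X: "X \<subseteq> V" "finite X" "card X = t"
    "\<And>x y. x \<in> X \<Longrightarrow> y \<in> X \<Longrightarrow> x \<noteq> y \<Longrightarrow> D x y = 0" by auto
  have "2 * card X div (2 * r - 1) = 0" using X(3) Suc.prems by (intro div_less) simp
  then obtain v where v: "v \<in> V - X" "(\<Sum>x\<in>X. D x v) \<le> 0"
    using extend_uniform[OF X(1,2)] X(3) Suc.prems s by auto
  have nn: "0 \<le> D x v" if "x \<in> X" for x using that v(1) X(1) by (intro D_nonneg) auto
  have "D x v = 0" if "x \<in> X" for x
  proof -
    have "D x v \<le> (\<Sum>x\<in>X. D x v)" using nn that X(2) by (intro member_le_sum) auto
    then show ?thesis using nn[OF that] v(2) by linarith
  qed
  then have "\<forall>x\<in>insert v X. \<forall>y\<in>insert v X. x \<noteq> y \<longrightarrow> D x y = 0"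
    using X(4) by (auto simp: D_commute)
  moreover have "insert v X \<subseteq> V" "finite (insert v X)" "card (insert v X) = Suc t"
    using X(1-3) v(1) by auto
  ultimately show ?case by blast
qed

text \<open>The optimal pattern on \<open>r + j\<close> vertices: \<open>r\<close> colour classes, of which \<open>r - j\<close> are
  singletons, with union \<open>S\<close>, and \<open>j\<close> are pairs of twins with shortfall \<open>1\<close>. Different classes
  have shortfall \<open>0\<close>.\<close>

definition doubled :: "nat \<Rightarrow> 'a set \<Rightarrow> ('a \<Rightarrow> nat) \<Rightarrow> 'a set \<Rightarrow> bool" where
  "doubled j X \<phi> S \<longleftrightarrow> X \<subseteq> V \<and> finite X \<and> card X = r + j \<and> \<phi> ` X = {..<r} \<and>
     (\<forall>x\<in>X. \<forall>y\<in>X. \<phi> x \<noteq> \<phi> y \<longrightarrow> D x y = 0) \<and> total X = int j \<and>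
     S \<subseteq> X \<and> card S = r - j \<and> (\<forall>x\<in>S. {y \<in> X. \<phi> y = \<phi> x} = {x}) \<and>
     (\<forall>x\<in>X - S. \<exists>x'\<in>X - S. x' \<noteq> x \<and> {y \<in> X. \<phi> y = \<phi> x} = {x, x'} \<and> D x x' = 1)"

text \<open>With at most \<open>2 r - 2\<close> vertices, the uniform extension gives a new vertex with total shortfall
  at most \<open>1\<close>. By \<open>full_colour_class\<close> this single unit covers a whole class, so the class is a
  singleton and the new vertex becomes the twin of its element.\<close>

lemma doubled_exists:
  assumes "j \<le> r - 1"
  shows "\<exists>X \<phi> S. doubled j X \<phi> S"
  using assms
proof (induction j)
  case 0
  obtain X where X: "X \<subseteq> V" "finite X" "card X = r"
    "\<And>x y. x \<in> X \<Longrightarrow> y \<in> X \<Longrightarrow> x \<noteq> y \<Longrightarrow> D x y = 0" using clique_exists[of r] by auto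
  obtain \<phi> where "bij_betw \<phi> X {..<r}"
    using X(2,3) finite_same_card_bij[of X "{..<r}"] by auto
  then have \<phi>: "inj_on \<phi> X" "\<phi> ` X = {..<r}" by (auto simp: bij_betw_def)
  have "total X = 0"
    unfolding total_def using X(4) by (intro sum.neutral) (auto simp: nsets_2_eq D_def)
  then have "doubled 0 X \<phi> X"
    using X \<phi> by (auto simp: doubled_def inj_on_def)
  then show ?case by blast
next
  case (Suc j)
  then obtain X \<phi> S where *: "doubled j X \<phi> S" by auto
  have X: "X \<subseteq> V" "finite X" "card X = r + j" "\<phi> ` X = {..<r}"
    "\<And>x y. x \<in> X \<Longrightarrow> y \<in> X \<Longrightarrow> \<phi> x \<noteq> \<phi> y \<Longrightarrow> D x y = 0" "total X = int j"
    "S \<subseteq> X" "card S = r - j"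
    and single: "\<And>x. x \<in> S \<Longrightarrow> {y \<in> X. \<phi> y = \<phi> x} = {x}"
    and pair: "\<And>x. x \<in> X - S \<Longrightarrow> \<exists>x'\<in>X - S. x' \<noteq> x \<and> {y \<in> X. \<phi> y = \<phi> x} = {x, x'} \<and> D x x' = 1"
    using * unfolding doubled_def by blast+
  have "2 * card X div (2 * r - 1) < 2"
    using X(3) Suc.prems by (intro less_mult_imp_div_less) simp
  then obtain v where v: "v \<in> V - X" "(\<Sum>x\<in>X. D x v) \<le> 1"
    using extend_uniform[OF X(1,2)] X(3) Suc.prems s by fastforce
  have nn: "0 \<le> D x v" if "x \<in> X" for x using that v(1) X(1) by (intro D_nonneg) auto
  obtain i where i: "i < r" "\<And>x. x \<in> X \<Longrightarrow> \<phi> x = i \<Longrightarrow> 1 \<le> D x v"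
    using full_colour_class[OF X(1,2,4,5) v(1)] by blast
  obtain x where x: "x \<in> X" "\<phi> x = i" using X(4) i(1) by (metis imageE lessThan_iff)
  have Dx: "1 \<le> D x v" using i(2) x by blast
  have sum1: "(\<Sum>y\<in>X. D y v) = D x v + (\<Sum>y\<in>X - {x}. D y v)"
    using X(2) x(1) by (simp add: sum.remove)
  have nn': "0 \<le> (\<Sum>y\<in>X - {x}. D y v)" using nn by (intro sum_nonneg) auto
  have D1: "D x v = 1" and rest: "(\<Sum>y\<in>X - {x}. D y v) = 0"
    using sum1 nn' Dx v(2) by linarith+
  have D0: "D y v = 0" if "y \<in> X" "y \<noteq> x" for y
    using sum_nonneg_eq_0_iff[of "X - {x}" "\<lambda>y. D y v"] nn rest X(2) that by auto
  have xS: "x \<in> S"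
  proof (rule ccontr)
    assume "x \<notin> S"
    then obtain x' where x': "x' \<in> X - S" "x' \<noteq> x" "{y \<in> X. \<phi> y = \<phi> x} = {x, x'}"
      using pair[of x] x(1) by blast
    then have "\<phi> x' = i" using x(2) by blast
    then show False using i(2)[of x'] D0[of x'] x' by auto
  qed
  define \<psi> where "\<psi> = \<phi>(v := i)"
  have old: "\<psi> y = \<phi> y" if "y \<in> X" for y using that v(1) by (auto simp: \<psi>_def)
  have new: "\<psi> v = i" by (simp add: \<psi>_def)
  have only: "y = x" if "y \<in> X" "\<phi> y = i" for y using single[OF xS] x that by auto
  have "doubled (Suc j) (insert v X) \<psi> (S - {x})"
    unfolding doubled_def
  proof (intro conjI ballI impI)
    show "insert v X \<subseteq> V" "finite (insert v X)" using X v by auto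
    show "card (insert v X) = r + Suc j" using X v by simp
    have "\<psi> ` X = {..<r}" using X(4) old by (metis image_cong)
    then show "\<psi> ` insert v X = {..<r}" using new i(1) by auto
    show "D y z = 0" if "y \<in> insert v X" "z \<in> insert v X" "\<psi> y \<noteq> \<psi> z" for y z
    proof -
      have D0': "D y v = 0" if "y \<in> X" "\<psi> y \<noteq> i" for y
        using D0[of y] that x(2) old[of y] by (cases "y = x") auto
      moreover have "D v y = 0" if "y \<in> X" "\<psi> y \<noteq> i" for y
        using D0'[OF that] by (simp only: D_commute[of v y])
      ultimately show ?thesis
        using that X(5)[of y z] old[of y] old[of z] new
        by (cases "y = v"; cases "z = v") auto
    qed
    show "total (insert v X) = int (Suc j)"
      using X v by (simp add: total_insert sum1 D1 rest)
    show "S - {x} \<subseteq> insert v X" using X by auto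
    show "card (S - {x}) = r - Suc j" using X xS finite_subset[OF X(7,2)] by simp
    show "{z \<in> insert v X. \<psi> z = \<psi> y} = {y}" if "y \<in> S - {x}" for y
    proof -
      have "y \<in> X" "y \<noteq> x" using that X(7) by auto
      then have "\<phi> y \<noteq> i" using only by blast
      then have "{z \<in> insert v X. \<psi> z = \<psi> y} = {z \<in> X. \<phi> z = \<phi> y}"
        using old new \<open>y \<in> X\<close> v(1) by auto
      also have "\<dots> = {y}" by (rule single) (use that in auto)
      finally show ?thesis .
    qed
    show "\<exists>x'\<in>insert v X - (S - {x}). x' \<noteq> y \<and> {z \<in> insert v X. \<psi> z = \<psi> y} = {y, x'} \<and> D y x' = 1"
      if "y \<in> insert v X - (S - {x})" for y
    proof (cases "y = v \<or> y = x")
      case True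
      have "z = v \<or> z = x" if "z \<in> insert v X" "\<psi> z = i" for z
        using that only[of z] old[of z] by auto
      moreover have "\<psi> x = i" using old[OF x(1)] x(2) by simp
      ultimately have e: "{z \<in> insert v X. \<psi> z = i} = {v, x}" using new x(1) by auto
      have "v \<noteq> x" "D v x = 1" using v(1) x(1) D1 D_commute[of v x] by auto
      moreover have "\<psi> y = i" using True old[OF x(1)] new x(2) by auto
      moreover obtain y' where "{y, y'} = {v, x}" using True by auto
      moreover have "y' \<noteq> y" "D y y' = 1"
        using calculation D1 by (auto simp: doubleton_eq_iff)
      moreover have "y' \<in> insert v X - (S - {x})"
        using calculation x(1) v(1) X(7) by (auto simp: doubleton_eq_iff)
      ultimately show ?thesis using e by (intro bexI[of _ y']) simp_all
    next
      case False
      then have y: "y \<in> X - S" using that by auto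
      then obtain x' where x': "x' \<in> X - S" "x' \<noteq> y" "{z \<in> X. \<phi> z = \<phi> y} = {y, x'}" "D y x' = 1"
        using pair by blast
      have "\<phi> y \<noteq> i" using only y False by blast
      then have "{z \<in> insert v X. \<psi> z = \<psi> y} = {z \<in> X. \<phi> z = \<phi> y}" using old new y v(1) by auto
      then show ?thesis using x' by (intro bexI[of _ x']) auto
    qed
  qed
  then show ?case by blast
qed

section \<open>Path, five-cycle and contradiction\<close>

text \<open>The exact weights: \<open>wt0\<close> on the untwinned vertex \<open>x0\<close> and \<open>wt1 / 2\<close> on each twin. All ways of
  joining a class of the pattern cost \<open>opt_loss\<close>, so a strictly cheaper vertex \<open>v\<close> can join none of
  them: its shortfall to \<open>x0\<close> is at most \<open>1\<close>, and at most one twin \<open>b\<close> has a positive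
  shortfall, then equal to \<open>1\<close>. The bounds for \<open>r + 1\<close> and \<open>2 r\<close> vertices force both to be \<open>1\<close>.\<close>

lemma path_exists:
  shows "\<exists>X \<phi> S x0 b v. doubled (r - 1) X \<phi> S \<and> S = {x0} \<and> b \<in> X - {x0} \<and> v \<in> V - X \<and>
    D x0 v = 1 \<and> D b v = 1 \<and> (\<forall>x\<in>X - {x0, b}. D x v = 0)"
proof -
  obtain X \<phi> S where *: "doubled (r - 1) X \<phi> S" using doubled_exists by blast
  have X: "X \<subseteq> V" "finite X" "card X = r + (r - 1)" "\<phi> ` X = {..<r}"
    "\<And>x y. x \<in> X \<Longrightarrow> y \<in> X \<Longrightarrow> \<phi> x \<noteq> \<phi> y \<Longrightarrow> D x y = 0" "total X = int (r - 1)"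
    "S \<subseteq> X" "card S = r - (r - 1)"
    and single: "\<And>x. x \<in> S \<Longrightarrow> {y \<in> X. \<phi> y = \<phi> x} = {x}"
    and pair: "\<And>x. x \<in> X - S \<Longrightarrow> \<exists>x'\<in>X - S. x' \<noteq> x \<and> {y \<in> X. \<phi> y = \<phi> x} = {x, x'} \<and> D x x' = 1"
    using * unfolding doubled_def by blast+
  have "card S = 1" using X(8) r by simp
  then obtain x0 where S: "S = {x0}" by (auto simp: card_1_singleton_iff)
  have x0: "x0 \<in> X" using X(7) S by simp
  define Y where "Y = X - {x0}"
  have Y: "finite Y" "real (card Y) = 2 * (real r - 1)" using X x0 r by (auto simp: Y_def of_nat_diff)
  define c where "c x = (if x = x0 then wt0 r a else wt1 r a / 2)" for x
  have a2: "a \<ge> 2" using a by simp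
  note C = r a2
  have split: "(\<Sum>x\<in>X. c x * f x) = wt0 r a * f x0 + wt1 r a / 2 * (\<Sum>x\<in>Y. f x)" for f
  proof -
    have "(\<Sum>x\<in>X. c x * f x) = c x0 * f x0 + (\<Sum>x\<in>Y. c x * f x)"
      using X(2) x0 by (simp add: sum.remove Y_def)
    also have "(\<Sum>x\<in>Y. c x * f x) = (\<Sum>x\<in>Y. wt1 r a / 2 * f x)"
      by (intro sum.cong) (auto simp: c_def Y_def)
    finally show ?thesis by (simp add: c_def sum_distrib_left)
  qed
  have "(\<Sum>x\<in>X. c x) = wt0 r a + wt1 r a / 2 * real (card Y)" using split[of "\<lambda>_. 1"] by simp
  then have csum: "(\<Sum>x\<in>X. c x) = 1" using wt_sum[OF C] Y(2) by (simp add: algebra_simps)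
  define \<kappa> where "\<kappa> x v = ln ((real a + 1) / real (w {x, v}))" for x v
  have "X \<noteq> {}" "card X \<le> s + 1" using x0 X(3) s by auto
  moreover have "0 < c x" for x using wt0_pos[OF C] wt1_pos[OF C] by (simp add: c_def)
  ultimately have "\<exists>v\<in>V - X. (\<Sum>x\<in>X. c x * \<kappa> x v) < opt_loss r a * (\<Sum>x\<in>X. c x)"
    unfolding \<kappa>_def using X(1,2) by (intro extend) auto
  then obtain v where v: "v \<in> V - X" "(\<Sum>x\<in>X. c x * \<kappa> x v) < opt_loss r a"
    using csum by auto
  have nn: "0 \<le> D x v" if "x \<in> X" for x using that v(1) X(1) by (intro D_nonneg) auto
  have wpos: "0 < w {x, v}" if "x \<in> X" for x
    using that v(1) X(1) by (intro pos) (auto simp: nsets_def card_insert_if)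
  have ge: "ln ((real a + 1) / real (a + 1 - d)) \<le> \<kappa> x v" if "x \<in> X" "int d \<le> D x v" "d \<le> a" for x d
  proof -
    have "real (w {x, v}) \<le> real (a + 1 - d)" using that(2,3) by (simp add: D_def)
    then show ?thesis unfolding \<kappa>_def using wpos[OF that(1)] that(3)
      by (intro ln_mono divide_left_mono) auto
  qed
  have ge0: "0 \<le> \<kappa> x v" if "x \<in> X" for x using ge[of x 0] nn that by (simp add: add.commute)
  have ge1: "gap1 a \<le> \<kappa> x v" if "x \<in> X" "1 \<le> D x v" for x
    using ge[of x 1] that a2 by (simp add: gap1_def)
  have ge2: "gap2 a \<le> \<kappa> x v" if "x \<in> X" "2 \<le> D x v" for x
    using ge[of x 2] that a2 by (simp add: gap2_def of_nat_diff)
  have cost: "wt0 r a * \<kappa> x0 v + wt1 r a / 2 * (\<Sum>x\<in>Y. \<kappa> x v) < opt_loss r a"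
    using v(2) split by simp
  have Ynn: "0 \<le> (\<Sum>x\<in>Z. \<kappa> x v)" if "Z \<subseteq> Y" for Z using ge0 that by (intro sum_nonneg) (auto simp: Y_def)
  have d0: "D x0 v \<le> 1"
  proof (rule ccontr)
    assume "\<not> ?thesis"
    then have "wt0 r a * gap2 a \<le> wt0 r a * \<kappa> x0 v"
      using ge2[of x0] x0 wt0_pos[OF C] by (intro mult_left_mono) auto
    moreover have "0 \<le> wt1 r a / 2 * (\<Sum>x\<in>Y. \<kappa> x v)" using Ynn wt1_pos[OF C] by simp
    ultimately show False using cost wt0_gap2[OF C] by linarith
  qed
  have Ysum: "(\<Sum>x\<in>Y. \<kappa> x v) < 2 * gap1 a"
  proof (rule ccontr)
    assume "\<not> ?thesis"
    then have "wt1 r a / 2 * (2 * gap1 a) \<le> wt1 r a / 2 * (\<Sum>x\<in>Y. \<kappa> x v)"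
      using wt1_pos[OF C] by (intro mult_left_mono) auto
    moreover have "0 \<le> wt0 r a * \<kappa> x0 v" using ge0 x0 wt0_pos[OF C] by simp
    ultimately show False using cost wt1_gap1[OF C] by simp
  qed
  have Y1: "D x v \<le> 1" if "x \<in> Y" for x
  proof (rule ccontr)
    assume "\<not> ?thesis"
    then have "gap2 a \<le> \<kappa> x v" using ge2 that by (auto simp: Y_def)
    moreover have "\<kappa> x v \<le> (\<Sum>x\<in>Y. \<kappa> x v)"
      using that Y(1) ge0 by (intro member_le_sum) (auto simp: Y_def)
    ultimately show False using Ysum gap2_ge[OF C] by linarith
  qed
  have Y2: "x = y" if "x \<in> Y" "y \<in> Y" "1 \<le> D x v" "1 \<le> D y v" for x y
  proof (rule ccontr)
    assume "x \<noteq> y"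
    then have "\<kappa> x v + \<kappa> y v = (\<Sum>x\<in>{x, y}. \<kappa> x v)" by simp
    also have "\<dots> \<le> (\<Sum>x\<in>Y. \<kappa> x v)"
      using that Y(1) ge0 by (intro sum_mono2) (auto simp: Y_def)
    finally show False using Ysum ge1[of x] ge1[of y] that by (auto simp: Y_def)
  qed
  obtain i where i: "i < r" "\<And>x. x \<in> X \<Longrightarrow> \<phi> x = i \<Longrightarrow> 1 \<le> D x v"
    using full_colour_class[OF X(1,2,4,5) v(1)] by blast
  obtain x where x: "x \<in> X" "\<phi> x = i" using X(4) i(1) by (metis imageE lessThan_iff)
  have "x = x0"
  proof (rule ccontr)
    assume "x \<noteq> x0"
    then obtain x' where "x' \<in> X - S" "x' \<noteq> x" "{y \<in> X. \<phi> y = \<phi> x} = {x, x'}"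
      using pair[of x] x S by blast
    then have "x' \<in> Y" "x' \<noteq> x" "1 \<le> D x' v" using i(2)[of x'] x S by (auto simp: Y_def)
    then show False using Y2[of x x'] i(2) x \<open>x \<noteq> x0\<close> by (auto simp: Y_def)
  qed
  then have d0': "D x0 v = 1" using i(2) x d0 by force
  have "int r + 1 \<le> total (insert v X)"
    using X v r by (intro total_double) auto
  then have "1 \<le> (\<Sum>x\<in>Y. D x v)"
    using X v x0 d0' r by (simp add: total_insert sum.remove Y_def of_nat_diff)
  then have "(\<Sum>x\<in>Y. D x v) \<noteq> 0" by linarith
  then have "\<exists>b\<in>Y. D b v \<noteq> 0" by (meson sum.neutral)
  then obtain b where b: "b \<in> Y" "D b v \<noteq> 0" by blast
  have "b \<in> X" using b(1) by (simp add: Y_def)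
  then have "D b v = 1" using b(2) Y1[OF b(1)] nn[of b] by linarith
  moreover have "D x v = 0" if "x \<in> X - {x0, b}" for x
  proof (rule ccontr)
    assume "D x v \<noteq> 0"
    then have "1 \<le> D x v" using nn[of x] that by auto
    then have "x = b" using Y2[of x b] that b(1) \<open>D b v = 1\<close> by (simp add: Y_def)
    then show False using that by simp
  qed
  ultimately show ?thesis using * S b(1) v(1) d0'
    by (intro exI[of _ X] exI[of _ \<phi>] exI[of _ S] exI[of _ x0] exI[of _ b] exI[of _ v]) (simp add: Y_def)
qed

text \<open>With \<open>c\<close> the twin of \<open>b\<close>, the shortfalls form the path \<open>x0 - v - b - c\<close>, and the set
  \<open>R\<close> of the remaining vertices consists of \<open>r - 2\<close> pairs of twins. Weights \<open>2\<close> on the path and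
  \<open>3\<close> on \<open>R\<close> make it too expensive to cover a pair of twins in \<open>R\<close> (cost \<open>6\<close>, with at most \<open>5\<close>
  permitted). The bounds for \<open>r + 1\<close> and \<open>2 r\<close> vertices then leave only a vertex \<open>u\<close> closing the
  path to the five-cycle
  \<open>x0 - v - b - c - u - x0\<close>. Each vertex of the five-cycle together with its opposite edge and
  \<open>R\<close> has total shortfall \<open>r - 1\<close>, so any further vertex \<open>z\<close> has shortfall at least \<open>2\<close> to
  it. Summing over the five choices contradicts the cost bound for the weights \<open>1\<close> on
  the cycle and \<open>2\<close> on \<open>R\<close>.\<close>

lemma impossible: False
proof -
  obtain X \<phi> S x0 b v where *: "doubled (r - 1) X \<phi> S" "S = {x0}"
    and b: "b \<in> X - {x0}" and v: "v \<in> V - X" "D x0 v = 1" "D b v = 1"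
    and v0: "\<And>x. x \<in> X - {x0, b} \<Longrightarrow> D x v = 0"
    using path_exists by blast
  have X: "X \<subseteq> V" "finite X" "card X = r + (r - 1)" "\<phi> ` X = {..<r}"
    "\<And>x y. x \<in> X \<Longrightarrow> y \<in> X \<Longrightarrow> \<phi> x \<noteq> \<phi> y \<Longrightarrow> D x y = 0" "total X = int (r - 1)" "x0 \<in> X"
    and single: "{y \<in> X. \<phi> y = \<phi> x0} = {x0}"
    and pair: "\<And>x. x \<in> X - {x0} \<Longrightarrow> \<exists>x'\<in>X - {x0}. x' \<noteq> x \<and> {y \<in> X. \<phi> y = \<phi> x} = {x, x'} \<and> D x x' = 1"
    using * unfolding doubled_def by blast+
  obtain c where c: "c \<in> X - {x0}" "c \<noteq> b" "{y \<in> X. \<phi> y = \<phi> b} = {b, c}" "D b c = 1"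
    using pair b by blast
  define R where "R = X - {x0, b, c}"
  have distinct: "x0 \<noteq> b" "x0 \<noteq> c" "b \<noteq> c" "v \<noteq> x0" "v \<noteq> b" "v \<noteq> c"
    using b c v X(7) by auto
  have R: "finite R" "R \<subseteq> V" "x0 \<notin> R" "b \<notin> R" "c \<notin> R" "v \<notin> R"
    using X v by (auto simp: R_def)
  have "card {x0, b, c} = 3" using distinct by simp
  then have cardR: "card R = 2 * r - 4"
    unfolding R_def using b c X(2,3,7) r by (subst card_Diff_subset) auto
  have inV: "x0 \<in> V" "b \<in> V" "c \<in> V" "v \<in> V" using b c X v by auto
  have Xeq: "X = insert x0 (insert b (insert c R))" using b c X(7) by (auto simp: R_def)
  have \<phi>R: "\<phi> x \<noteq> \<phi> x0 \<and> \<phi> x \<noteq> \<phi> b" if "x \<in> R" for x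
  proof -
    have "x \<notin> {y \<in> X. \<phi> y = \<phi> x0}" "x \<notin> {y \<in> X. \<phi> y = \<phi> b}"
      unfolding single c(3) using that by (auto simp: R_def)
    then show ?thesis using that by (simp add: R_def)
  qed
  have "b \<notin> {y \<in> X. \<phi> y = \<phi> x0}" unfolding single using b by simp
  then have \<phi>ob: "\<phi> x0 \<noteq> \<phi> b" using b by auto
  have "c \<in> {y \<in> X. \<phi> y = \<phi> b}" unfolding c(3) by simp
  then have \<phi>cb: "\<phi> c = \<phi> b" by simp
  have DR: "D x x0 = 0" "D x b = 0" "D x c = 0" "D x v = 0" if "x \<in> R" for x
  proof -
    have "x \<in> X" "b \<in> X" "c \<in> X" "x \<in> X - {x0, b}" using that b c by (auto simp: R_def)
    then show "D x x0 = 0" "D x b = 0" "D x c = 0" "D x v = 0"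
      using \<phi>R[OF that] \<phi>cb X(7) by (auto intro: X(5) v0)
  qed
  have SR: "(\<Sum>x\<in>R. D x x0) = 0" "(\<Sum>x\<in>R. D x b) = 0" "(\<Sum>x\<in>R. D x c) = 0" "(\<Sum>x\<in>R. D x v) = 0"
    using DR by simp_all
  have Dob: "D x0 b = 0" "D b x0 = 0" "D x0 c = 0" "D c x0 = 0"
    using X(5)[of x0 b] X(5)[of x0 c] \<phi>ob \<phi>cb b c X(7) by (auto simp: D_commute)
  have Dcv: "D c v = 0" "D v c = 0" using v0[of c] c distinct by (auto simp: D_commute)
  have Dv: "D v x0 = 1" "D v b = 1" "D c b = 1" using v c by (auto simp: D_commute)
  have totR: "total R = int r - 2"
    using X(6) R distinct Dob c(4) SR r unfolding Xeq
    by (simp add: total_insert D_commute of_nat_diff)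
  \<comment> \<open>The weights on the path and on \<open>R\<close> sum to \<open>6 r - 4\<close>, so the permitted cost
    \<open>2 (6 r - 4) / (2 r - 1)\<close> is just below \<open>6\<close>.\<close>
  define P where "P = {x0, b, c, v}"
  define k where "k x = (if x \<in> P then 2 else 3 :: nat)" for x
  have k: "0 < k x \<and> k x \<le> 3" for x by (simp add: k_def)
  have PR: "P \<inter> R = {}" "finite P" "card P = 4" "P \<subseteq> V"
    using R distinct inV by (auto simp: P_def)
  have cardPR: "card (P \<union> R) = 2 * r"
    using PR R(1) cardR r by (subst card_Un_disjoint) auto
  have ksum: "(\<Sum>x\<in>P \<union> R. int (k x) * f x) = 2 * (f x0 + f b + f c + f v) + 3 * (\<Sum>x\<in>R. f x)" for f
  proof -
    have "(\<Sum>x\<in>P \<union> R. int (k x) * f x) = (\<Sum>x\<in>P. int (k x) * f x) + (\<Sum>x\<in>R. int (k x) * f x)"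
      using PR R(1) by (intro sum.union_disjoint) auto
    also have "(\<Sum>x\<in>R. int (k x) * f x) = (\<Sum>x\<in>R. 3 * f x)"
      using PR by (intro sum.cong) (auto simp: k_def)
    also have "(\<Sum>x\<in>P. int (k x) * f x) = 2 * (f x0 + f b + f c + f v)"
      using distinct by (simp add: P_def k_def)
    finally show ?thesis by (simp add: sum_distrib_left)
  qed
  have "(\<Sum>x\<in>P \<union> R. int (k x)) = 8 + 3 * (2 * int r - 4)"
    using ksum[of "\<lambda>_. 1"] cardR r by (simp add: of_nat_diff)
  then have ktot: "(\<Sum>x\<in>P \<union> R. int (k x)) = 6 * int r - 4" by simp
  have subP: "P \<union> R \<subseteq> V" "finite (P \<union> R)" "card (P \<union> R) \<le> s + 1"
    using PR R cardPR s by simp_all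
  obtain u where u: "u \<in> V - (P \<union> R)"
    "(2 * int r - 1) * (\<Sum>x\<in>P \<union> R. int (k x) * D x u) \<le> 2 * (\<Sum>x\<in>P \<union> R. int (k x))"
    using extend_linear[of "P \<union> R" k, OF subP k] by blast
  define \<rho> where "\<rho> = (\<Sum>x\<in>R. D x u)"
  have "2 * (D x0 u + D b u + D c u + D v u) + 3 * \<rho> < 6"
  proof (rule ccontr)
    assume "\<not> ?thesis"
    then have "(2 * int r - 1) * 6 \<le> (2 * int r - 1) * (2 * (D x0 u + D b u + D c u + D v u) + 3 * \<rho>)"
      using r by (intro mult_left_mono) auto
    then show False using u(2) unfolding ktot ksum \<rho>_def[symmetric] by simp
  qed
  then have cost: "2 * (D x0 u + D b u + D c u + D v u) + 3 * \<rho> < 6" .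
  have nn: "0 \<le> D x0 u" "0 \<le> D b u" "0 \<le> D c u" "0 \<le> D v u"
    using u(1) inV by (auto intro!: D_nonneg simp: P_def)
  have nnR: "0 \<le> D x u" if "x \<in> R" for x using that u(1) R(2) by (intro D_nonneg) auto
  have \<rho>0: "0 \<le> \<rho>" unfolding \<rho>_def by (intro sum_nonneg nnR)
  have uX: "u \<in> V - X" using u(1) by (auto simp: Xeq P_def)
  have noR: "\<not> (\<forall>y\<in>R. \<phi> y = i \<longrightarrow> 1 \<le> D y u)" if "x \<in> R" "\<phi> x = i" for x i
  proof
    assume all: "\<forall>y\<in>R. \<phi> y = i \<longrightarrow> 1 \<le> D y u"
    have "x \<in> X - {x0}" using that by (simp add: R_def)
    then obtain x' where x': "x' \<in> X - {x0}" "x' \<noteq> x" "{y \<in> X. \<phi> y = \<phi> x} = {x, x'}"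
      using pair by meson
    have "x' \<in> {y \<in> X. \<phi> y = \<phi> x}" unfolding x'(3) by simp
    then have e: "\<phi> x' = \<phi> x" by simp
    have "x' \<in> R" using x' e \<phi>R[OF that(1)] \<phi>cb by (auto simp: R_def)
    have "D x u + D x' u = (\<Sum>x\<in>{x, x'}. D x u)" using x' by simp
    also have "\<dots> \<le> \<rho>" unfolding \<rho>_def
      using that \<open>x' \<in> R\<close> R(1) nnR by (intro sum_mono2) auto
    finally have "D x u + D x' u \<le> \<rho>" .
    moreover have "1 \<le> D x u" "1 \<le> D x' u" using all that e \<open>x' \<in> R\<close> by auto
    ultimately have "2 \<le> \<rho>" by linarith
    then show False using cost nn by (smt (verit))
  qed
  \<comment> \<open>The path is symmetric, so it also carries the colouring in which \<open>{x0, v}\<close> are twins and \<open>c\<close> is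
    the singleton. No class inside \<open>R\<close> is fully covered (\<open>noR\<close>), so each of the two colourings
    gives one of the following alternatives.\<close>
  have alt1: "1 \<le> D x0 u \<or> (1 \<le> D b u \<and> 1 \<le> D c u)"
  proof -
    obtain i where i: "i < r" "\<And>x. x \<in> X \<Longrightarrow> \<phi> x = i \<Longrightarrow> 1 \<le> D x u"
      using full_colour_class[OF X(1,2,4,5) uX] by blast
    obtain x where x: "x \<in> X" "\<phi> x = i" using X(4) i(1) by (metis imageE lessThan_iff)
    have "x \<notin> R" using noR[of x i] i(2) x by (auto simp: R_def)
    then have "x = x0 \<or> \<phi> x = \<phi> b" using x(1) \<phi>cb by (auto simp: R_def)
    moreover have "b \<in> X" "c \<in> X" using b c(1) by auto
    ultimately show ?thesis using i(2)[of x0] i(2)[of b] i(2)[of c] x(2) X(7) \<phi>cb by metis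
  qed
  have alt2: "1 \<le> D c u \<or> (1 \<le> D x0 u \<and> 1 \<le> D v u)"
  proof -
    define Z where "Z = insert v (insert x0 (insert c R))"
    define \<psi> where "\<psi> = \<phi>(v := \<phi> x0)"
    have \<psi>: "\<psi> x0 = \<phi> x0" "\<psi> c = \<phi> b" "\<psi> v = \<phi> x0" "\<And>x. x \<in> R \<Longrightarrow> \<psi> x = \<phi> x"
      using distinct R \<phi>cb by (auto simp: \<psi>_def)
    have "\<psi> ` R = \<phi> ` R" using \<psi>(4) by (intro image_cong) auto
    then have img: "\<psi> ` Z = {..<r}"
      using X(4) \<psi>(1-3) \<phi>cb unfolding Z_def Xeq by auto
    have cr: "D x y = 0" if "x \<in> Z" "y \<in> Z" "\<psi> x \<noteq> \<psi> y" for x y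
    proof -
      have "D x y = 0" if "x \<in> R" "y \<in> R" "\<psi> x \<noteq> \<psi> y" for x y
        using that \<psi>(4) X(5)[of x y] by (auto simp: R_def)
      then show ?thesis
        using that \<psi>(1-3) DR Dob Dcv D_commute unfolding Z_def by (metis insert_iff)
    qed
    have "Z \<subseteq> V" "finite Z" "u \<in> V - Z"
      using R inV u(1) by (auto simp: Z_def P_def)
    then obtain i where i: "i < r" "\<And>x. x \<in> Z \<Longrightarrow> \<psi> x = i \<Longrightarrow> 1 \<le> D x u"
      using full_colour_class[of Z \<psi> u, OF _ _ img cr] by blast
    obtain x where x: "x \<in> Z" "\<psi> x = i" using img i(1) by (metis imageE lessThan_iff)
    have "x \<notin> R" using noR[of x i] i(2) x \<psi>(4) by (auto simp: Z_def)
    then have "\<psi> x = \<psi> x0 \<or> x = c" using x(1) \<psi>(1,3) by (auto simp: Z_def)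
    moreover have "x0 \<in> Z" "v \<in> Z" "c \<in> Z" by (auto simp: Z_def)
    ultimately show ?thesis using i(2)[of x0] i(2)[of v] i(2)[of c] x(2) \<psi>(1,3) by metis
  qed
  have uR: "u \<notin> R" "u \<noteq> x0" "u \<noteq> b" "u \<noteq> c" "u \<noteq> v" using u(1) by (auto simp: P_def)
  have four: "int r + 1 \<le> total (insert z (insert p (insert q (insert t R))))"
    if "z \<in> V" "p \<in> V" "q \<in> V" "t \<in> V" "z \<notin> R" "p \<notin> R" "q \<notin> R" "t \<notin> R"
      "p \<noteq> q" "p \<noteq> t" "q \<noteq> t" "z \<noteq> p" "z \<noteq> q" "z \<noteq> t" for z p q t
    using that R cardR r by (intro total_double) auto
  \<comment> \<open>The three path vertices in \<open>c1\<close> and in \<open>c2\<close> span shortfall \<open>1\<close>, and \<open>R\<close> has \<open>r - 2\<close>.\<close>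
  have c1: "2 \<le> D x0 u + D b u + D c u + \<rho>"
    using four[of u x0 b c] R uR distinct inV u(1) totR SR Dob c(4)
    by (simp add: total_insert D_commute \<rho>_def[symmetric])
  have c2: "2 \<le> D x0 u + D v u + D c u + \<rho>"
    using four[of u x0 v c] R uR distinct inV u(1) totR SR Dob Dcv v(2)
    by (simp add: total_insert D_commute \<rho>_def[symmetric])
  have Du: "D x0 u = 1" "D c u = 1" "D b u = 0" "D v u = 0" "\<rho> = 0"
    using alt1 alt2 c1 c2 cost nn \<rho>0 by (smt (verit))+
  have DuR: "D x u = 0" if "x \<in> R" for x
    using Du(5) that sum_nonneg_eq_0_iff[OF R(1) nnR] by (auto simp: \<rho>_def)
  \<comment> \<open>The weights on the five-cycle and on \<open>R\<close> sum to \<open>4 r - 3\<close>, so the permitted cost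
    \<open>2 (4 r - 3) / (2 r - 1)\<close> is just below \<open>4\<close>.\<close>
  define Q where "Q = {x0, v, b, c, u}"
  define m where "m x = (if x \<in> Q then 1 else 2 :: nat)" for x
  have m: "0 < m x \<and> m x \<le> 3" for x by (simp add: m_def)
  have QR: "Q \<inter> R = {}" "finite Q" "card Q = 5" "Q \<subseteq> V"
    using R distinct inV u(1) uR by (auto simp: Q_def)
  have cardQR: "card (Q \<union> R) = 2 * r + 1"
    using QR R(1) cardR r by (subst card_Un_disjoint) auto
  have msum: "(\<Sum>x\<in>Q \<union> R. int (m x) * f x) = (f x0 + f v + f b + f c + f u) + 2 * (\<Sum>x\<in>R. f x)" for f
  proof -
    have "(\<Sum>x\<in>Q \<union> R. int (m x) * f x) = (\<Sum>x\<in>Q. int (m x) * f x) + (\<Sum>x\<in>R. int (m x) * f x)"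
      using QR R(1) by (intro sum.union_disjoint) auto
    also have "(\<Sum>x\<in>R. int (m x) * f x) = (\<Sum>x\<in>R. 2 * f x)"
      using QR by (intro sum.cong) (auto simp: m_def)
    also have "(\<Sum>x\<in>Q. int (m x) * f x) = f x0 + f v + f b + f c + f u"
      using distinct uR by (simp add: Q_def m_def)
    finally show ?thesis by (simp add: sum_distrib_left)
  qed
  have "(\<Sum>x\<in>Q \<union> R. int (m x)) = 5 + 2 * (2 * int r - 4)"
    using msum[of "\<lambda>_. 1"] cardR r by (simp add: of_nat_diff)
  then have mtot: "(\<Sum>x\<in>Q \<union> R. int (m x)) = 4 * int r - 3" by simp
  have subQ: "Q \<union> R \<subseteq> V" "finite (Q \<union> R)" "card (Q \<union> R) \<le> s + 1"
    using QR R cardQR s by simp_all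
  obtain z where z: "z \<in> V - (Q \<union> R)"
    "(2 * int r - 1) * (\<Sum>x\<in>Q \<union> R. int (m x) * D x z) \<le> 2 * (\<Sum>x\<in>Q \<union> R. int (m x))"
    using extend_linear[of "Q \<union> R" m, OF subQ m] by blast
  define \<sigma> where "\<sigma> = (\<Sum>x\<in>R. D x z)"
  have zcost: "D x0 z + D v z + D b z + D c z + D u z + 2 * \<sigma> < 4"
  proof (rule ccontr)
    assume "\<not> ?thesis"
    then have "(2 * int r - 1) * 4 \<le> (2 * int r - 1) * ((D x0 z + D v z + D b z + D c z + D u z) + 2 * \<sigma>)"
      using r by (intro mult_left_mono) auto
    then show False using z(2) unfolding mtot msum \<sigma>_def[symmetric] by simp
  qed
  have znn: "0 \<le> D x0 z" "0 \<le> D v z" "0 \<le> D b z" "0 \<le> D c z" "0 \<le> D u z"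
    using z(1) inV u(1) by (auto intro!: D_nonneg simp: Q_def)
  have \<sigma>0: "0 \<le> \<sigma>" unfolding \<sigma>_def using z(1) R(2) by (intro sum_nonneg D_nonneg) auto
  have zR: "z \<notin> R" "z \<noteq> x0" "z \<noteq> b" "z \<noteq> c" "z \<noteq> v" "z \<noteq> u" using z(1) by (auto simp: Q_def)
  have triple: "2 \<le> D p z + D q z + D t z + \<sigma>"
    if "p \<in> Q" "q \<in> Q" "t \<in> Q" "p \<noteq> q" "p \<noteq> t" "q \<noteq> t" "D q p + D t p + D t q = 1" for p q t
  proof -
    have zero: "(\<Sum>x\<in>R. D x y) = 0" if "y \<in> Q" for y
      using that SR DuR by (auto simp: Q_def)
    have "p \<notin> R" "q \<notin> R" "t \<notin> R" using that QR(1) by auto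
    moreover have "p \<in> V" "q \<in> V" "t \<in> V" using that QR(4) by auto
    moreover have "z \<noteq> p" "z \<noteq> q" "z \<noteq> t" using that z(1) by auto
    ultimately show ?thesis
      using four[of z p q t] z(1) zR(1) R that totR zero[of p] zero[of q] zero[of t]
      by (auto simp: total_insert \<sigma>_def[symmetric])
  qed
  have "2 \<le> D x0 z + D b z + D c z + \<sigma>" "2 \<le> D v z + D c z + D u z + \<sigma>"
    "2 \<le> D b z + D u z + D x0 z + \<sigma>" "2 \<le> D c z + D x0 z + D v z + \<sigma>" "2 \<le> D u z + D v z + D b z + \<sigma>"
    using distinct uR Dob Dcv Dv Du c(4) v
    by (auto intro!: triple simp: Q_def D_commute)
  then show False using zcost znn \<sigma>0 by (smt (verit))
qed

end

section \<open>The product of the multiplicities in dense graphs\<close>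

lemma weight_le_of_subset_sums:
  fixes w :: "'a set \<Rightarrow> nat"
  assumes "finite V" "2 \<le> s" "s \<le> card V"
    and q: "\<And>X. X \<in> nsets V s \<Longrightarrow> (\<Sum>e\<in>nsets X 2. w e) \<le> q"
    and e: "e \<in> nsets V 2"
  shows "w e \<le> q"
proof -
  have "e \<subseteq> V" "finite e" "card e = 2" using e by (auto simp: nsets_def)
  then obtain X where X: "e \<subseteq> X" "X \<subseteq> V" "card X = s"
    using exists_subset_between[of e s V] assms by auto
  have "finite X" using X(2) assms(1) by (rule finite_subset)
  then have "w e \<le> (\<Sum>e\<in>nsets X 2. w e)"
    using X(1) \<open>finite e\<close> \<open>card e = 2\<close>
    by (intro member_le_sum) (auto simp: nsets_def finite_imp_finite_nsets)
  also have "\<dots> \<le> q" using X \<open>finite X\<close> by (intro q) (auto simp: nsets_def)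
  finally show ?thesis .
qed

text \<open>Suppose that all logarithmic degrees are larger. If some small \<open>X\<close> with weights \<open>c\<close> had no
  cheap outside vertex, then summing the costs over all outside vertices would bound the weighted
  degree sum of \<open>X\<close>; the pairs inside \<open>X\<close> contribute too little to make up the difference once
  \<open>\<epsilon> * (card V - 1)\<close> is at least \<open>(s + 1) ln q\<close>. So the graph is a \<open>rich_multigraph\<close>.\<close>

lemma low_degree_vertex:
  fixes w :: "'a set \<Rightarrow> nat"
  assumes r: "r \<ge> 2" and s: "s \<ge> 2 * r" and a: "a \<ge> 12 * (s + 1)"
    and V: "finite V" "s + 2 \<le> card V"
    and q: "\<And>X. X \<in> nsets V s \<Longrightarrow> (\<Sum>e\<in>nsets X 2. w e) \<le> q"
    and qd: "q + deficit r s \<le> (a + 1) * (s choose 2)"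
    and pos: "\<And>e. e \<in> nsets V 2 \<Longrightarrow> 0 < w e"
    and \<epsilon>: "(real s + 1) * ln (real q) \<le> \<epsilon> * (real (card V) - 1)"
  shows "\<exists>v\<in>V. (\<Sum>u\<in>V - {v}. ln (real (w {u, v})))
           \<le> (ln (opt_rate r a) + \<epsilon>) * (real (card V) - 1)"
proof (rule ccontr)
  assume "\<not> ?thesis"
  then have big: "(ln (opt_rate r a) + \<epsilon>) * (real (card V) - 1) < (\<Sum>u\<in>V - {v}. ln (real (w {u, v})))"
    if "v \<in> V" for v using that by (meson not_le)
  have a2: "a \<ge> 2" using a by simp
  note C = r a2
  have edge: "{x, y} \<in> nsets V 2" if "x \<in> V" "y \<in> V" "x \<noteq> y" for x y
    using that by (simp add: nsets_def)
  have w_le: "w e \<le> q" if "e \<in> nsets V 2" for e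
    by (rule weight_le_of_subset_sums[of V s]) (use r s V that q in auto)
  have ln_le: "ln (real (w {x, y})) \<le> ln (real q)" if "x \<in> V" "y \<in> V" "x \<noteq> y" for x y
    using w_le[OF edge[OF that]] pos[OF edge[OF that]] by simp
  have "rich_multigraph V w r s a"
  proof
    show "r \<ge> 2" "s \<ge> 2 * r" "a \<ge> 12 * (s + 1)" by fact+
    show "V \<noteq> {}" using V(2) by auto
    show "0 < w e" if "e \<in> nsets V 2" for e using pos that by blast
    show "int (deficit r s) \<le> (\<Sum>e\<in>nsets X 2. int a + 1 - int (w e))" if "X \<in> nsets V s" for X
    proof -
      have "card X = s" using that by (simp add: nsets_def)
      then have "card (nsets X 2) = s choose 2" by (simp add: card_nsets)
      then have "(\<Sum>e\<in>nsets X 2. int a + 1 - int (w e))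
          = int ((a + 1) * (s choose 2)) - int (\<Sum>e\<in>nsets X 2. w e)"
        by (simp add: sum_subtractf algebra_simps)
      then show ?thesis using q[OF that] qd by linarith
    qed
    fix X :: "'a set" and c :: "'a \<Rightarrow> real"
    assume X: "X \<subseteq> V" "X \<noteq> {}" "finite X" "card X \<le> s + 1" and c: "\<And>x. x \<in> X \<Longrightarrow> 0 < c x"
    define K where "K = (\<Sum>x\<in>X. c x)"
    have K: "0 < K" unfolding K_def using X c by (intro sum_pos) auto
    have cardX: "1 \<le> card X" using X(2,3) by (simp add: Suc_leI card_gt_0_iff)
    show "\<exists>v\<in>V - X. (\<Sum>x\<in>X. c x * ln ((real a + 1) / real (w {x, v}))) < opt_loss r a * (\<Sum>x\<in>X. c x)"
    proof (rule ccontr)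
      assume "\<not> ?thesis"
      then have *: "opt_loss r a * K \<le> (\<Sum>x\<in>X. c x * ln ((real a + 1) / real (w {x, v})))"
        if "v \<in> V - X" for v using that by (auto simp: K_def not_less)
      have up: "(\<Sum>x\<in>X. c x * ln (real (w {x, v}))) \<le> ln (opt_rate r a) * K" if v: "v \<in> V - X" for v
      proof -
        have "ln ((real a + 1) / real (w {x, v})) = ln (real a + 1) - ln (real (w {x, v}))"
          if "x \<in> X" for x
        proof -
          have "0 < w {x, v}" using that v X(1) by (intro pos edge) auto
          then show ?thesis by (simp add: ln_div)
        qed
        then have "(\<Sum>x\<in>X. c x * ln ((real a + 1) / real (w {x, v})))
            = (\<Sum>x\<in>X. c x * ln (real a + 1) - c x * ln (real (w {x, v})))"
          by (intro sum.cong) (auto simp: right_diff_distrib)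
        also have "\<dots> = K * ln (real a + 1) - (\<Sum>x\<in>X. c x * ln (real (w {x, v})))"
          by (simp add: sum_subtractf K_def sum_distrib_right)
        finally have "(\<Sum>x\<in>X. c x * ln (real (w {x, v}))) \<le> K * ln (real a + 1) - opt_loss r a * K"
          using *[OF v] by linarith
        also have "\<dots> = ln (opt_rate r a) * K"
          by (simp add: ln_opt_rate(1)[OF C] left_diff_distrib)
        finally show ?thesis .
      qed
      have low: "ln (opt_rate r a) * (real (card V) - 1) < (\<Sum>v\<in>V - X. ln (real (w {x, v})))"
        if x: "x \<in> X" for x
      proof -
        have "(\<Sum>v\<in>X - {x}. ln (real (w {x, v}))) \<le> (\<Sum>v\<in>X - {x}. ln (real q))"
          using x X(1) by (intro sum_mono ln_le) auto
        also have "\<dots> = real (card X - 1) * ln (real q)" using x X(3) by simp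
        also have "\<dots> \<le> (real s + 1) * ln (real q)"
        proof (intro mult_right_mono)
          have "\<not> V \<subseteq> {x}" using V(2) card_mono[of "{x}" V] by auto
          then obtain y where "y \<in> V" "y \<noteq> x" by blast
          then have "0 < w {x, y}" "w {x, y} \<le> q" using edge[of x y] pos w_le x X(1) by auto
          then show "0 \<le> ln (real q)" by simp
        qed (use X(4) in linarith)
        finally have near: "(\<Sum>v\<in>X - {x}. ln (real (w {x, v}))) \<le> \<epsilon> * (real (card V) - 1)"
          using \<epsilon> by linarith
        have "V - {x} = (V - X) \<union> (X - {x})" using x X(1) by auto
        then have "(\<Sum>v\<in>V - {x}. ln (real (w {x, v})))
            = (\<Sum>v\<in>V - X. ln (real (w {x, v}))) + (\<Sum>v\<in>X - {x}. ln (real (w {x, v})))"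
          using V(1) X(3) by (simp only:) (intro sum.union_disjoint, auto)
        moreover have "(\<Sum>v\<in>V - {x}. ln (real (w {x, v}))) = (\<Sum>v\<in>V - {x}. ln (real (w {v, x})))"
          by (simp add: insert_commute[of x])
        ultimately show ?thesis using big[of x] x X(1) near by (auto simp: distrib_right)
      qed
      have "ln (opt_rate r a) * (real (card V) - 1) * K
          = (\<Sum>x\<in>X. c x * (ln (opt_rate r a) * (real (card V) - 1)))"
        unfolding K_def sum_distrib_right[symmetric] by (rule mult.commute)
      also have "\<dots> < (\<Sum>x\<in>X. c x * (\<Sum>v\<in>V - X. ln (real (w {x, v}))))"
        using X c low by (intro sum_strict_mono mult_strict_left_mono) auto
      also have "\<dots> = (\<Sum>v\<in>V - X. \<Sum>x\<in>X. c x * ln (real (w {x, v})))"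
        by (simp add: sum_distrib_left sum.swap[of _ X])
      also have "\<dots> \<le> (\<Sum>v\<in>V - X. ln (opt_rate r a) * K)" by (intro sum_mono up)
      also have "\<dots> = (real (card V) - real (card X)) * (ln (opt_rate r a) * K)"
        using X V by (simp add: card_Diff_subset of_nat_diff card_mono)
      also have "\<dots> \<le> (real (card V) - 1) * (ln (opt_rate r a) * K)"
        using cardX K ln_opt_rate(2)[OF C] by (intro mult_right_mono) auto
      finally show False by (simp add: mult_ac)
    qed
  qed
  then show False by (rule rich_multigraph.impossible)
qed

text \<open>Remove low-degree vertices until fewer than \<open>N\<close> remain. The remaining multiplicities are still
  at most \<open>q\<close> because at least \<open>s\<close> vertices are left.\<close>

lemma log_weight_sum_le:
  fixes w :: "'a set \<Rightarrow> nat"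
  assumes r: "r \<ge> 2" and s: "s \<ge> 2 * r" and a: "a \<ge> 12 * (s + 1)"
    and V: "finite V" "s \<le> card V"
    and q: "\<And>X. X \<in> nsets V s \<Longrightarrow> (\<Sum>e\<in>nsets X 2. w e) \<le> q"
    and qd: "q + deficit r s \<le> (a + 1) * (s choose 2)"
    and pos: "\<And>e. e \<in> nsets V 2 \<Longrightarrow> 0 < w e"
    and N: "s + 2 \<le> N" "(real s + 1) * ln (real q) \<le> \<epsilon> * (real N - 1)" and \<epsilon>: "0 < \<epsilon>"
  shows "(\<Sum>e\<in>nsets V 2. ln (real (w e)))
     \<le> (ln (opt_rate r a) + \<epsilon>) * real (card V choose 2) + real (N choose 2) * ln (real q)"
  using V q pos
proof (induction "card V" arbitrary: V rule: less_induct)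
  case less
  have a2: "a \<ge> 2" using a by simp
  note C = r a2
  have w_le: "w e \<le> q" if "e \<in> nsets V 2" for e
    by (rule weight_le_of_subset_sums[of V s]) (use r s less.prems(1,2,3) that in auto)
  have "card (nsets V 2) > 0" using less.prems(1,2) r s by (simp add: card_nsets)
  then obtain e0 where e0: "e0 \<in> nsets V 2" by (metis card.empty equals0I less_irrefl)
  have lnq: "0 \<le> ln (real q)" using w_le[OF e0] less.prems(4)[OF e0] by simp
  show ?case
  proof (cases "card V < N")
    case True
    have "(\<Sum>e\<in>nsets V 2. ln (real (w e))) \<le> (\<Sum>e\<in>nsets V 2. ln (real q))"
      using w_le less.prems(4) by (intro sum_mono ln_mono) auto
    also have "\<dots> = real (card V choose 2) * ln (real q)" using less.prems(1) by (simp add: card_nsets)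
    also have "\<dots> \<le> real (N choose 2) * ln (real q)"
      using True lnq by (intro mult_right_mono) (auto intro: binomial_right_mono)
    also have "\<dots> \<le> (ln (opt_rate r a) + \<epsilon>) * real (card V choose 2) + real (N choose 2) * ln (real q)"
      using ln_opt_rate(2)[OF C] \<epsilon> by simp
    finally show ?thesis .
  next
    case False
    then have card: "s + 2 \<le> card V" using N(1) by simp
    have "(real s + 1) * ln (real q) \<le> \<epsilon> * (real (card V) - 1)"
    proof -
      have "\<epsilon> * (real N - 1) \<le> \<epsilon> * (real (card V) - 1)"
        using False \<epsilon> by (intro mult_left_mono) auto
      then show ?thesis using N(2) by linarith
    qed
    then obtain v where v: "v \<in> V" "(\<Sum>u\<in>V - {v}. ln (real (w {u, v})))
           \<le> (ln (opt_rate r a) + \<epsilon>) * (real (card V) - 1)"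
      using low_degree_vertex[OF r s a less.prems(1) card less.prems(3) qd less.prems(4)] by auto
    define W where "W = V - {v}"
    have W: "finite W" "v \<notin> W" "V = insert v W" "card V = Suc (card W)"
      using v(1) less.prems(1) card by (auto simp: W_def card_Suc_Diff1)
    have sub: "nsets W k \<subseteq> nsets V k" for k using W(3) by (intro nsets_mono) auto
    have IH: "(\<Sum>e\<in>nsets W 2. ln (real (w e)))
        \<le> (ln (opt_rate r a) + \<epsilon>) * real (card W choose 2) + real (N choose 2) * ln (real q)"
      using sub W card less.prems(3,4) by (intro less.hyps) auto
    have "(\<Sum>e\<in>nsets V 2. ln (real (w e)))
        = (\<Sum>e\<in>nsets W 2. ln (real (w e))) + (\<Sum>u\<in>W. ln (real (w {u, v})))"
      using sum_nsets_insert[OF W(1,2)] W(3) by simp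
    also have "\<dots> \<le> (ln (opt_rate r a) + \<epsilon>) * real (card W choose 2) + real (N choose 2) * ln (real q)
        + (ln (opt_rate r a) + \<epsilon>) * real (card W)"
      using IH v(2) W(4) by (simp add: W_def)
    also have "\<dots> = (ln (opt_rate r a) + \<epsilon>) * real (card V choose 2) + real (N choose 2) * ln (real q)"
      unfolding W(4) by (simp add: numeral_2_eq_2 algebra_simps)
    finally show ?thesis .
  qed
qed

section \<open>Graphs given by colourings\<close>

lemma T1_graph_colouring:
  assumes "G \<in> T1_graphs r a n" "a \<ge> 1"
  shows "\<exists>f. f ` {1..n} \<subseteq> {..<r} \<and> (\<forall>e\<in>nsets {1..n} 2. mult G e + loss unit_loss f e = a + 1)"
proof -
  have V: "verts G = {1..n}" using assms by (simp add: T1_graphs_def)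
  obtain U where U: "disjoint_family_on U {..<r}" "(\<Union>i<r. U i) = {1..n}"
    "\<And>e. e \<in> nsets (U 0) 2 \<Longrightarrow> mult G e = a - 1"
    "\<And>i e. i \<in> {1..<r} \<Longrightarrow> e \<in> nsets (U i) 2 \<Longrightarrow> mult G e = a"
    "\<And>e. e \<in> nsets {1..n} 2 \<Longrightarrow> (\<forall>i<r. \<not> e \<subseteq> U i) \<Longrightarrow> mult G e = a + 1"
    using assms(1) unfolding T1_graphs_def by (clarsimp simp: V)
  define f where "f v = (SOME i. i < r \<and> v \<in> U i)" for v
  have f: "f v < r" "v \<in> U (f v)" if "v \<in> {1..n}" for v
  proof -
    have "\<exists>i. i < r \<and> v \<in> U i" using that U(2) by auto
    then show "f v < r" "v \<in> U (f v)" unfolding f_def by (metis (mono_tags, lifting) someI_ex)+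
  qed
  have "mult G e + loss unit_loss f e = a + 1" if e: "e \<in> nsets {1..n} 2" for e
  proof -
    obtain u v where uv: "e = {u, v}" "u \<noteq> v" "u \<in> {1..n}" "v \<in> {1..n}"
      using e unfolding nsets_2_eq by blast
    show ?thesis
    proof (cases "f u = f v")
      case True
      then have "e \<in> nsets (U (f v)) 2" using f(2)[OF uv(3)] f(2)[OF uv(4)] uv by (simp add: nsets_def)
      then show ?thesis
        using U(3)[of e] U(4)[of "f v" e] True f(1)[OF uv(4)] assms(2) uv(1)
        by (cases "f v = 0") (auto simp: loss_pair)
    next
      case False
      have "\<not> e \<subseteq> U i" if "i < r" for i
      proof
        assume sub: "e \<subseteq> U i"
        have "f x = i" if "x \<in> {1..n}" "x \<in> U i" for x
          using U(1) f[OF that(1)] \<open>i < r\<close> that(2) unfolding disjoint_family_on_def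
          by (metis disjoint_iff lessThan_iff)
        then show False using False sub uv by auto
      qed
      then show ?thesis using U(5)[OF e] False uv(1) by (simp add: loss_pair)
    qed
  qed
  then show ?thesis using f(1) by (intro exI[of _ f]) auto
qed

definition coloured_graph :: "nat \<Rightarrow> (nat \<Rightarrow> nat) \<Rightarrow> nat \<Rightarrow> nat multigraph" where
  "coloured_graph a f n = ({1..n}, restrict (\<lambda>e. a + 1 - loss unit_loss f e) (nsets {1..n} 2))"

lemma coloured_graph_T1:
  assumes "\<And>v. f v < r"
  shows "coloured_graph a f n \<in> T1_graphs r a n"
proof -
  let ?U = "\<lambda>i. {v \<in> {1..n}. f v = i}"
  have inside: "e \<in> nsets {1..n} 2 \<and> loss unit_loss f e = unit_loss i" if e: "e \<in> nsets (?U i) 2" for e i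
  proof -
    obtain u v where "e = {u, v}" "u \<noteq> v" "u \<in> ?U i" "v \<in> ?U i"
      using e unfolding nsets_2_eq by blast
    then show ?thesis by (simp add: nsets_def loss_pair)
  qed
  have across: "loss unit_loss f e = 0" if "e \<in> nsets {1..n} 2" "\<forall>i<r. \<not> e \<subseteq> ?U i" for e
    using that assms by (fastforce simp: nsets_2_eq loss_pair)
  show ?thesis unfolding T1_graphs_def
  proof (intro CollectI conjI exI[of _ ?U] ballI impI)
    show "disjoint_family_on ?U {..<r}" by (auto simp: disjoint_family_on_def)
    show "(\<Union>i<r. ?U i) = verts (coloured_graph a f n)"
      using assms by (auto simp: coloured_graph_def)
    show "mult (coloured_graph a f n) e = a - 1" if "e \<in> nsets (?U 0) 2" for e
      using inside[OF that] by (simp add: coloured_graph_def)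
    show "mult (coloured_graph a f n) e = a" if "i \<in> {1..<r}" "e \<in> nsets (?U i) 2" for i e
      using inside[OF that(2)] that(1) by (simp add: coloured_graph_def)
    show "mult (coloured_graph a f n) e = a + 1"
      if "e \<in> nsets (verts (coloured_graph a f n)) 2" "\<forall>i<r. \<not> e \<subseteq> ?U i" for e
      using across[of e] that by (simp add: coloured_graph_def)
  qed (auto simp: coloured_graph_def multigraph_def)
qed

lemma T1_graphs_finite:
  assumes "a \<ge> 1"
  shows "finite (T1_graphs r a n)"
proof (rule finite_subset)
  show "T1_graphs r a n \<subseteq> {{1..n}} \<times> (nsets {1..n} 2 \<rightarrow>\<^sub>E {..a + 1})"
  proof
    fix G assume G: "G \<in> T1_graphs r a n"
    obtain f where f: "\<forall>e\<in>nsets {1..n} 2. mult G e + loss unit_loss f e = a + 1"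
      using T1_graph_colouring[OF G assms] by blast
    have "mult G \<in> extensional (nsets {1..n} 2)" "verts G = {1..n}"
      using G by (auto simp: T1_graphs_def multigraph_def PiE_def)
    moreover have "mult G e \<le> a + 1" if "e \<in> nsets {1..n} 2" for e using f that by fastforce
    ultimately show "G \<in> {{1..n}} \<times> (nsets {1..n} 2 \<rightarrow>\<^sub>E {..a + 1})"
      by (cases G) (auto simp: PiE_def)
  qed
  show "finite ({{1..n}} \<times> (nsets {1..n} 2 \<rightarrow>\<^sub>E {..a + 1}))"
    by (intro finite_cartesian_product finite_PiE) (auto simp: finite_imp_finite_nsets)
qed

lemma Sigma1_upper:
  assumes "r \<ge> 1" "a \<ge> 1"
  shows "Sigma1 r a s + deficit r s \<le> (a + 1) * (s choose 2)"
proof -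
  have "T1_graphs r a s \<noteq> {}" using coloured_graph_T1[of "\<lambda>_. 0" r a s] assms(1) by auto
  then have "Sigma1 r a s \<in> edge_sum ` T1_graphs r a s"
    unfolding Sigma1_def using T1_graphs_finite[OF assms(2)] by (intro Max_in) auto
  then obtain G where G: "G \<in> T1_graphs r a s" "Sigma1 r a s = edge_sum G" by blast
  obtain f where f: "f ` {1..s} \<subseteq> {..<r}" "\<forall>e\<in>nsets {1..s} 2. mult G e + loss unit_loss f e = a + 1"
    using T1_graph_colouring[OF G(1) assms(2)] by blast
  have "verts G = {1..s}" using G(1) by (simp add: T1_graphs_def)
  then have "edge_sum G + (\<Sum>e\<in>nsets {1..s} 2. loss unit_loss f e) = (\<Sum>e\<in>nsets {1..s} 2. a + 1)"
    unfolding edge_sum_def using f(2) by (simp add: sum.distrib[symmetric])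
  also have "\<dots> = (a + 1) * (s choose 2)" by (simp add: card_nsets)
  finally show ?thesis
    using deficit_le_loss[OF _ f(1) assms(1)] G(2) by simp
qed

text \<open>Carrying the colouring of an \<open>s\<close>-subset over to \<open>{1..s}\<close> gives a member of \<open>T1_graphs\<close>
  with the same edge sum.\<close>

lemma coloured_graph_sq:
  assumes f: "\<And>v. f v < r" and a: "a \<ge> 1"
  shows "coloured_graph a f n \<in> sq_graphs n s (Sigma1 r a s)"
proof -
  have "(\<Sum>e\<in>nsets X 2. mult (coloured_graph a f n) e) \<le> Sigma1 r a s"
    if X: "X \<in> nsets {1..n} s" for X
  proof -
    have "finite X" "card X = s" "X \<subseteq> {1..n}" using X by (auto simp: nsets_def)
    then obtain g where g: "bij_betw g {1..s} X"
      using finite_same_card_bij[of "{1..s}" X] by auto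
    have bij: "bij_betw (\<lambda>e. g ` e) (nsets {1..s} 2) (nsets X 2)"
      using g by (rule bij_betw_nsets)
    have "nsets X 2 \<subseteq> nsets {1..n} 2" using \<open>X \<subseteq> {1..n}\<close> by (rule nsets_mono)
    then have "(\<Sum>e\<in>nsets X 2. mult (coloured_graph a f n) e)
        = (\<Sum>e\<in>nsets X 2. a + 1 - loss unit_loss f e)"
      by (intro sum.cong) (auto simp: coloured_graph_def)
    also have "\<dots> = (\<Sum>e\<in>nsets {1..s} 2. a + 1 - loss unit_loss f (g ` e))"
      using sum.reindex_bij_betw[OF bij, of "\<lambda>e. a + 1 - loss unit_loss f e"] by simp
    also have "\<dots> = edge_sum (coloured_graph a (f \<circ> g) s)"
      unfolding edge_sum_def by (simp add: coloured_graph_def loss_compose)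
    also have "\<dots> \<le> Sigma1 r a s"
      unfolding Sigma1_def using coloured_graph_T1[of "f \<circ> g" r a s] f T1_graphs_finite[OF a]
      by (intro Max_ge) auto
    finally show ?thesis .
  qed
  then show ?thesis
    by (auto simp: sq_graphs_def sq_graph_def coloured_graph_def multigraph_def)
qed

lemma sq_graphs_finite:
  assumes "2 \<le> s" "s \<le> n"
  shows "finite (sq_graphs n s q)"
proof (rule finite_subset)
  show "sq_graphs n s q \<subseteq> {{1..n}} \<times> (nsets {1..n} 2 \<rightarrow>\<^sub>E {..q})"
  proof
    fix G assume "G \<in> sq_graphs n s q"
    then have G: "mult G \<in> extensional (nsets {1..n} 2)" "verts G = {1..n}"
      "\<And>X. X \<in> nsets {1..n} s \<Longrightarrow> (\<Sum>e\<in>nsets X 2. mult G e) \<le> q"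
      by (auto simp: sq_graphs_def sq_graph_def multigraph_def PiE_def)
    have "mult G e \<le> q" if "e \<in> nsets {1..n} 2" for e
      by (rule weight_le_of_subset_sums[of "{1..n}" s]) (use assms G(3) that in auto)
    then show "G \<in> {{1..n}} \<times> (nsets {1..n} 2 \<rightarrow>\<^sub>E {..q})"
      using G by (cases G) (auto simp: PiE_def)
  qed
  show "finite ({{1..n}} \<times> (nsets {1..n} 2 \<rightarrow>\<^sub>E {..q}))"
    by (intro finite_cartesian_product finite_PiE) (auto simp: finite_imp_finite_nsets)
qed

section \<open>Bounds on the extremal product and the limit\<close>

lemma edge_prod_exp:
  assumes "finite (verts G)" "\<And>e. e \<in> nsets (verts G) 2 \<Longrightarrow> 0 < mult G e"
  shows "real (edge_prod G) = exp (\<Sum>e\<in>nsets (verts G) 2. ln (real (mult G e)))"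
  using assms by (simp add: edge_prod_def exp_sum finite_imp_finite_nsets)

lemma ex_Pi_fin_lower:
  assumes r: "r \<ge> 2" and a: "a \<ge> 2" and n: "2 \<le> s" "s \<le> n"
  shows "exp (ln (opt_rate r a) * real (n choose 2)) \<le> real (ex_Pi_fin n s (Sigma1 r a s))"
proof -
  define p where "p i = (if i = 0 then wt0 r a else wt1 r a)" for i :: nat
  define L where "L i = (if i = 0 then gap2 a else gap1 a)" for i :: nat
  have "\<exists>f. (\<forall>v. f v < r) \<and> (\<Sum>e\<in>nsets {1..n} 2. loss L f e) \<le> opt_loss r a * real (n choose 2)"
  proof (rule greedy_colouring)
    show "p i \<ge> 0" for i
      using wt0_pos[OF r a] wt1_pos[OF r a] by (simp add: p_def)
    show "(\<Sum>i<r. p i) = 1" unfolding p_def sum_colours_weights[OF r] by (rule wt_sum[OF r a])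
    show "p i * L i = opt_loss r a" for i
      using wt0_gap2[OF r a] wt1_gap1[OF r a] by (simp add: p_def L_def)
  qed
  then obtain f where f: "\<And>v. f v < r"
    "(\<Sum>e\<in>nsets {1..n} 2. loss L f e) \<le> opt_loss r a * real (n choose 2)" by blast
  let ?G = "coloured_graph a f n"
  have mem: "?G \<in> sq_graphs n s (Sigma1 r a s)" using coloured_graph_sq[OF f(1)] a by simp
  have verts: "verts ?G = {1..n}" by (simp add: coloured_graph_def)
  have m: "0 < mult ?G e" "ln (real (mult ?G e)) = ln (real a + 1) - loss L f e"
    if e: "e \<in> nsets {1..n} 2" for e
  proof -
    obtain u v where "e = {u, v}" using e by (auto simp: nsets_2_eq)
    moreover have "mult ?G e = a + 1 - loss unit_loss f e" using e by (simp add: coloured_graph_def)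
    ultimately show "0 < mult ?G e" "ln (real (mult ?G e)) = ln (real a + 1) - loss L f e"
      using a by (auto simp: loss_pair L_def gap1_def gap2_def ln_div of_nat_diff add.commute)
  qed
  have "(\<Sum>e\<in>nsets {1..n} 2. ln (real (mult ?G e)))
      = (\<Sum>e\<in>nsets {1..n} 2. ln (real a + 1) - loss L f e)"
    using m(2) by (intro sum.cong) auto
  also have "\<dots> = ln (real a + 1) * real (n choose 2) - (\<Sum>e\<in>nsets {1..n} 2. loss L f e)"
    by (simp add: sum_subtractf card_nsets)
  finally have "ln (opt_rate r a) * real (n choose 2) \<le> (\<Sum>e\<in>nsets {1..n} 2. ln (real (mult ?G e)))"
    using f(2) by (simp add: ln_opt_rate(1)[OF r a] left_diff_distrib)
  then have "exp (ln (opt_rate r a) * real (n choose 2)) \<le> real (edge_prod ?G)"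
    using edge_prod_exp[of ?G] m(1) verts by simp
  also have "edge_prod ?G \<le> ex_Pi_fin n s (Sigma1 r a s)"
    unfolding ex_Pi_fin_def using mem sq_graphs_finite[OF n] by (intro Max_ge) auto
  finally show ?thesis by simp
qed

lemma ex_Pi_fin_upper:
  assumes r: "r \<ge> 2" and s: "s \<ge> 2 * r" and a: "a \<ge> 12 * (s + 1)" and n: "s \<le> n"
    and N: "s + 2 \<le> N" "(real s + 1) * ln (real (Sigma1 r a s)) \<le> \<epsilon> * (real N - 1)" and \<epsilon>: "0 < \<epsilon>"
  shows "real (ex_Pi_fin n s (Sigma1 r a s))
    \<le> exp ((ln (opt_rate r a) + \<epsilon>) * real (n choose 2) + real (N choose 2) * ln (real (Sigma1 r a s)))"
proof -
  define q where "q = Sigma1 r a s"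
  have a1: "a \<ge> 1" and r1: "r \<ge> 1" and s2: "2 \<le> s" using a r s by simp_all
  have "sq_graphs n s q \<noteq> {}"
    using coloured_graph_sq[of "\<lambda>_. 0" r a n s] r a1 by (auto simp: q_def)
  then have "ex_Pi_fin n s q \<in> edge_prod ` sq_graphs n s q"
    unfolding ex_Pi_fin_def using sq_graphs_finite[OF s2 n] by (intro Max_in) auto
  then obtain G where G: "G \<in> sq_graphs n s q" "ex_Pi_fin n s q = edge_prod G" by blast
  have V: "verts G = {1..n}" and qb: "\<And>X. X \<in> nsets {1..n} s \<Longrightarrow> (\<Sum>e\<in>nsets X 2. mult G e) \<le> q"
    using G(1) by (auto simp: sq_graphs_def sq_graph_def)
  have "real (edge_prod G)
      \<le> exp ((ln (opt_rate r a) + \<epsilon>) * real (n choose 2) + real (N choose 2) * ln (real q))"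
  proof (cases "\<exists>e\<in>nsets {1..n} 2. mult G e = 0")
    case True
    then have "edge_prod G = 0"
      unfolding edge_prod_def V by (simp add: finite_imp_finite_nsets)
    then show ?thesis by simp
  next
    case False
    then have pos: "0 < mult G e" if "e \<in> nsets {1..n} 2" for e using that by auto
    have "(\<Sum>e\<in>nsets {1..n} 2. ln (real (mult G e)))
        \<le> (ln (opt_rate r a) + \<epsilon>) * real (card {1..n} choose 2) + real (N choose 2) * ln (real q)"
      using n N(2) qb pos Sigma1_upper[OF r1 a1] unfolding q_def
      by (intro log_weight_sum_le[OF r s a _ _ _ _ _ N(1) _ \<epsilon>]) auto
    then show ?thesis using edge_prod_exp[of G] pos V by simp
  qed
  then show ?thesis using G(2) by (simp add: q_def)
qed

text \<open>The lower bound holds without error term, and the upper bound loses \<open>\<epsilon>\<close> plus a constant divided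
  by the number of pairs.\<close>

lemma ex_Pi_seq_tendsto:
  assumes r: "r \<ge> 2" and s: "s \<ge> 2 * r" and a: "a \<ge> 12 * (s + 1)"
  shows "ex_Pi_seq s (Sigma1 r a s) \<longlonglongrightarrow> opt_rate r a"
proof -
  define \<pi> where "\<pi> = ln (opt_rate r a)"
  define q where "q = Sigma1 r a s"
  have a2: "a \<ge> 2" and s2: "2 \<le> s" using a r s by simp_all
  have rate: "opt_rate r a = exp \<pi>" by (simp add: \<pi>_def opt_rate_def add_nonneg_pos)
  have lower: "exp \<pi> \<le> ex_Pi_seq s q n" if "n \<ge> s" for n
  proof -
    have c: "0 < real (n choose 2)" using that s2 by simp
    have "exp \<pi> = exp (\<pi> * real (n choose 2)) powr (1 / real (n choose 2))"
      using c by (simp add: powr_def)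
    also have "\<dots> \<le> real (ex_Pi_fin n s q) powr (1 / real (n choose 2))"
      using ex_Pi_fin_lower[OF r a2 s2 that] by (intro powr_mono2) (auto simp: \<pi>_def q_def)
    finally show ?thesis by (simp add: ex_Pi_seq_def)
  qed
  have upper: "\<exists>C. \<forall>n\<ge>s. ex_Pi_seq s q n \<le> exp (\<pi> + \<epsilon> + C / real (n choose 2))" if \<epsilon>: "0 < \<epsilon>" for \<epsilon>
  proof -
    obtain M :: nat where M: "(real s + 1) * ln (real q) / \<epsilon> \<le> real M" using real_arch_simple by blast
    define N where "N = M + s + 2"
    have "(real s + 1) * ln (real q) \<le> \<epsilon> * real M" using M \<epsilon> by (simp add: field_simps)
    also have "\<dots> \<le> \<epsilon> * (real N - 1)" using \<epsilon> by (simp add: N_def)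
    finally have N: "s + 2 \<le> N" "(real s + 1) * ln (real q) \<le> \<epsilon> * (real N - 1)" by (auto simp: N_def)
    define C where "C = real (N choose 2) * ln (real q)"
    have "ex_Pi_seq s q n \<le> exp (\<pi> + \<epsilon> + C / real (n choose 2))" if "n \<ge> s" for n
    proof -
      have c: "0 < real (n choose 2)" using that s2 by simp
      have "ex_Pi_seq s q n \<le> exp ((\<pi> + \<epsilon>) * real (n choose 2) + C) powr (1 / real (n choose 2))"
        unfolding ex_Pi_seq_def
        using ex_Pi_fin_upper[OF r s a that N[unfolded q_def] \<epsilon>]
        by (intro powr_mono2) (auto simp: \<pi>_def q_def C_def)
      also have "\<dots> = exp (((\<pi> + \<epsilon>) * real (n choose 2) + C) / real (n choose 2))"
        by (simp add: powr_def)
      also have "((\<pi> + \<epsilon>) * real (n choose 2) + C) / real (n choose 2) = \<pi> + \<epsilon> + C / real (n choose 2)"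
        using c by (simp add: add_divide_distrib)
      finally show ?thesis .
    qed
    then show ?thesis by blast
  qed
  have "ex_Pi_seq s q \<longlonglongrightarrow> exp \<pi>"
  proof (rule order_tendstoI)
    fix l assume "l < exp \<pi>"
    then have "l < ex_Pi_seq s q n" if "n \<ge> s" for n using lower[OF that] by linarith
    then show "\<forall>\<^sub>F n in sequentially. l < ex_Pi_seq s q n"
      by (rule eventually_sequentiallyI)
  next
    fix u assume u: "exp \<pi> < u"
    define \<epsilon> where "\<epsilon> = (ln u - \<pi>) / 2"
    have "0 < u" using u exp_gt_zero less_trans by blast
    then have "\<pi> < ln u" using u by (simp add: exp_less_cancel_iff flip: exp_less_cancel_iff[of \<pi> "ln u"])
    then have \<epsilon>: "0 < \<epsilon>" by (simp add: \<epsilon>_def)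
    obtain C where C: "\<And>n. n \<ge> s \<Longrightarrow> ex_Pi_seq s q n \<le> exp (\<pi> + \<epsilon> + C / real (n choose 2))"
      using upper[OF \<epsilon>] by blast
    have grow: "real n \<le> real (n choose 2) + 1" for n
      by (induction n) (auto simp: numeral_2_eq_2)
    have "filterlim (\<lambda>n. real (n choose 2)) at_top sequentially"
    proof (rule filterlim_at_top_mono)
      show "filterlim (\<lambda>n. real n - 1) at_top sequentially"
        using filterlim_tendsto_add_at_top[OF tendsto_const[of "-1 :: real"] filterlim_real_sequentially]
        by simp
      show "\<forall>\<^sub>F n in sequentially. real n - 1 \<le> real (n choose 2)"
        using grow by (intro always_eventually) (simp add: algebra_simps)
    qed
    then have "(\<lambda>n. C / real (n choose 2)) \<longlonglongrightarrow> 0"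
      by (rule real_tendsto_divide_at_top[OF tendsto_const])
    then have "\<forall>\<^sub>F n in sequentially. C / real (n choose 2) < \<epsilon>" using \<epsilon> by (rule order_tendstoD(2))
    then show "\<forall>\<^sub>F n in sequentially. ex_Pi_seq s q n < u"
      using eventually_ge_at_top[of s]
    proof eventually_elim
      case (elim n)
      have "exp (\<pi> + \<epsilon> + C / real (n choose 2)) < exp (ln u)"
        using elim(1) by (simp add: \<epsilon>_def field_simps)
      then show ?case using C[OF elim(2)] \<open>0 < u\<close> by simp
    qed
  qed
  then show ?thesis by (simp add: rate q_def)
qed

theorem theorem1p12:
  fixes r s :: nat
  assumes "2 * r \<ge> 4" and "s \<ge> 2 * r"
  shows "\<exists>a0 :: nat. \<forall>a :: nat. a \<ge> a0 \<longrightarrow>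
     convergent (ex_Pi_seq s (Sigma1 r a s)) \<and>
     ex_Pi s (Sigma1 r a s) =
       (real a + 1) powr ((real r - 2 + x_star1 r a) / (real r - 1)) *
       real a powr ((1 - x_star1 r a) / (real r - 1))"
proof (intro exI[of _ "12 * (s + 1)"] allI impI)
  fix a :: nat assume a: "a \<ge> 12 * (s + 1)"
  have r: "r \<ge> 2" and a2: "a \<ge> 2" using assms(1) a by simp_all
  note lim = ex_Pi_seq_tendsto[OF r assms(2) a]
  show "convergent (ex_Pi_seq s (Sigma1 r a s)) \<and>
     ex_Pi s (Sigma1 r a s) =
       (real a + 1) powr ((real r - 2 + x_star1 r a) / (real r - 1)) *
       real a powr ((1 - x_star1 r a) / (real r - 1))"
    unfolding opt_rate_eq[OF r a2] ex_Pi_def using limI[OF lim] convergentI[OF lim] by simp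
qed

end
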